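(* Let $\mathbb{F}$ be an algebraically closed field of characteristic zero, let $\mathcal{C}\subset\mathbb{F}^2$ be an irreducible affine plane curve parametrizable by radicals, and let $d\in\mathbb{F}\setminus\{0\}$. Then the offset to $\mathcal{C}$ at distance $d$ is also parametrizable by radicals.
   Context: Let $f(x,y)\in\mathbb{F}[x,y]$ be the defining polynomial of $\mathcal{C}$ and write $\|(x,y)\|_2^2=x^2+y^2$ ($\|(x,y)\|_2$ being a square root of $x^2+y^2$ in $\mathbb{F}$). The offset to $\mathcal{C}$ at distance $d$ is the Zariski closure in $\mathbb{F}^2$ of $$\Big\{P\pm\frac{d}{\|\nabla(f)(P)\|_2}\nabla(f)(P)\ :\ P\in\mathcal{C},\ \|\nabla(f)(P)\|_2\neq0\Big\},\qquad \nabla(f)(P)=\Big(\frac{\partial f}{\partial x}(P),\frac{\partial f}{\partial y}(P)\Big).$$ Let $t$ be transcendental over $\mathbb{F}$, $\mathbb{K}=\mathbb{F}(t)$, and fix an algebraic closure $\overline{\mathbb{K}}$ of $\mathbb{K}$. Root towers. For $g\in\mathbb{K}[x]$, a root tower for $g$ over $\mathbb{K}$ is a finite tower of fields $\mathbb{K}=\mathbb{K}_0\subset\mathbb{K}_1\subset\cdots\subset\mathbb{K}_s=\mathbb{E}$ (inside $\overline{\mathbb{K}}$) such that each $\mathbb{K}_i$ is the splitting field over $\mathbb{K}_{i-1}$ of a polynomial $x^{\ell_i}-a_i\in\mathbb{K}_{i-1}[x]$ with $\ell_i>0$, $a_i\neq0$, and the splitting field of $g$ over $\mathbb{K}$ is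 contained in $\mathbb{K}_s$; $g$ is soluble (by radicals) over $\mathbb{K}$ if such a tower exists. Affine square parametrization: a tuple $(R_1,\ldots,R_n)\in\mathbb{E}^n\setminus\mathbb{F}^n$, where $\mathbb{E}$ is the last field of a root tower over $\mathbb{K}$ of some $g\in\mathbb{K}[x]$ soluble over $\mathbb{K}$. Evaluation. For each $t_0\in\mathbb{F}$ fix a place of $\overline{\mathbb{K}}$ over $\mathbb{F}$ extending $t\mapsto t_0$, i.e. a valuation ring $O_{t_0}\supset\mathbb{F}$ of $\overline{\mathbb{K}}$ with $t-t_0$ in its maximal ideal; its residue field is $\mathbb{F}$ (this is a compatible choice of the values at $t_0$ of all radicals). $S(t_0)$ is well defined if $S\in O_{t_0}$, and then it is the residue of $S$ in $\mathbb{F}$; tuples are evaluated coordinatewise. Parametrizable by radicals. A set $\mathcal{E}\subset\mathbb{F}^n$ (an irreducible affine curve, or the offset, which may be reducible) is parametrizable by radicals if there is a finite set of square parametrizations $\{\mathcal{P}_i(t)\}_i$ such that (1) for all $i$ and all $t_0\in\mathbb{F}$ such that $\mathcal{P}_i(t_0)$ is defined, $\mathcal{P}_i(t_0)\in\mathcal{E}$; (2) for all but finitely many $P\in\mathcal{E}$ there exist $t_0\in\mathbb{F}$ and $i$ with $P=\mathcal{P}_i(t_0)$. *)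

theory Defs
  imports
    "HOL-Algebra.Algebraic_Closure_Type"
    "HOL-Algebra.Generated_Fields"
    "HOL-Computational_Algebra.Polynomial_Factorial"
    "HOL-Analysis.Cartesian_Space"
begin

text \<open>
  The constant field \<open>F\<close> is a type \<open>'a\<close>, \<open>K = F(t)\<close> is the fraction field of \<open>'a poly\<close>,
  and the algebraic closure of \<open>K\<close> is the library's \<open>alg_closure\<close> of it. Intermediate fields and
  valuation rings are sets of elements of that closure, regarded as subsets of the carrier of
  \<open>ring_of_type_algebra\<close>.
\<close>

type_synonym 'a ratfun_closure = "'a poly fract alg_closure"

definition const_rf :: "'a::field \<Rightarrow> 'a ratfun_closure" where
  "const_rf c = to_ac (to_fract [:c:])"

definition t_rf :: "'a::field ratfun_closure" where
  "t_rf = to_ac (to_fract [:0, 1:])"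

section \<open>Root towers\<close>

text \<open>
  The splitting field over \<open>L\<close> of a polynomial with coefficients in \<open>L\<close>, inside an algebraically
  closed field: all its roots already lie in the ambient field, so it is \<open>L\<close> with the roots adjoined.
\<close>

definition splitting_field :: "'b::alg_closed_field set \<Rightarrow> 'b poly \<Rightarrow> 'b set" where
  "splitting_field L p = generate_field ring_of_type_algebra (L \<union> {x. poly p x = 0})"

definition root_tower ::
  "'a::field poly fract poly \<Rightarrow> 'a ratfun_closure set list \<Rightarrow> bool" where
  "root_tower g Ks \<longleftrightarrow>
     Ks \<noteq> [] \<and> hd Ks = range to_ac \<and>
     (\<forall>i. Suc i < length Ks \<longrightarrow>
        (\<exists>l>0. \<exists>a\<in>Ks ! i. a \<noteq> 0 \<and>
           Ks ! Suc i = splitting_field (Ks ! i) (monom 1 l - [:a:]))) \<and>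
     splitting_field (range to_ac) (map_poly to_ac g) \<subseteq> last Ks"

definition soluble_by_radicals :: "'a::field poly fract poly \<Rightarrow> bool" where
  "soluble_by_radicals g \<longleftrightarrow> (\<exists>Ks. root_tower g Ks)"

definition square_parametrization :: "('a::field ratfun_closure) ^ 'n \<Rightarrow> bool" where
  "square_parametrization R \<longleftrightarrow>
     (\<exists>g Ks. soluble_by_radicals g \<and> root_tower g Ks \<and> (\<forall>i. R $ i \<in> last Ks)) \<and>
     \<not> (\<forall>i. R $ i \<in> range const_rf)"

section \<open>Evaluation\<close>

definition val_max_ideal :: "'b::field set \<Rightarrow> 'b set" where
  "val_max_ideal V = {x \<in> V. x = 0 \<or> inverse x \<notin> V}"

text \<open>
  A valuation ring of the closure that contains \<open>F\<close> and has \<open>t - t0\<close> in its maximal ideal. Its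
  residue field is algebraic over \<open>F\<close>, hence equal to \<open>F\<close>; this is a consequence of the conditions
  and is not imposed.
\<close>

definition place_at :: "'a::field \<Rightarrow> 'a ratfun_closure set \<Rightarrow> bool" where
  "place_at t0 V \<longleftrightarrow>
     subring V ring_of_type_algebra \<and>
     (\<forall>x. x \<in> V \<or> inverse x \<in> V) \<and>
     range const_rf \<subseteq> V \<and>
     t_rf - const_rf t0 \<in> val_max_ideal V"

definition residue :: "'a::field ratfun_closure set \<Rightarrow> 'a ratfun_closure \<Rightarrow> 'a" where
  "residue V S = (THE c. S - const_rf c \<in> val_max_ideal V)"

definition defined_at :: "'a::field ratfun_closure set \<Rightarrow> ('a ratfun_closure) ^ 'n \<Rightarrow> bool" where
  "defined_at V R \<longleftrightarrow> (\<forall>i. R $ i \<in> V)"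

definition value_at :: "'a::field ratfun_closure set \<Rightarrow> ('a ratfun_closure) ^ 'n \<Rightarrow> 'a ^ 'n" where
  "value_at V R = (\<chi> i. residue V (R $ i))"

text \<open>Here \<open>pl t0\<close> is the place chosen at \<open>t0\<close>.\<close>

definition parametrizable_by_radicals ::
  "('a::field \<Rightarrow> 'a ratfun_closure set) \<Rightarrow> ('a ^ 'n) set \<Rightarrow> bool" where
  "parametrizable_by_radicals pl E \<longleftrightarrow>
     (\<exists>Ps. finite Ps \<and> (\<forall>R\<in>Ps. square_parametrization R) \<and>
        (\<forall>R\<in>Ps. \<forall>t0. defined_at (pl t0) R \<longrightarrow> value_at (pl t0) R \<in> E) \<and>
        finite {P \<in> E. \<not> (\<exists>t0. \<exists>R\<in>Ps. defined_at (pl t0) R \<and> P = value_at (pl t0) R)})"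

section \<open>Plane curves and their offsets\<close>

text \<open>
  A polynomial in \<open>x, y\<close> is represented in \<open>F[x][y]\<close>: the outer variable is \<open>y = v $ 2\<close>, and the
  coefficients are polynomials in \<open>x = v $ 1\<close>.
\<close>

definition eval2 :: "'a::comm_ring_1 poly poly \<Rightarrow> 'a ^ 2 \<Rightarrow> 'a" where
  "eval2 f v = poly (poly f [:v $ 2:]) (v $ 1)"

definition plane_curve :: "'a::comm_ring_1 poly poly \<Rightarrow> ('a ^ 2) set" where
  "plane_curve f = {P. eval2 f P = 0}"

definition zariski_closure :: "('a::comm_ring_1 ^ 2) set \<Rightarrow> ('a ^ 2) set" where
  "zariski_closure S = {Q. \<forall>h. (\<forall>P\<in>S. eval2 h P = 0) \<longrightarrow> eval2 h Q = 0}"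

definition grad2 :: "'a::idom poly poly \<Rightarrow> 'a ^ 2 \<Rightarrow> 'a ^ 2" where
  "grad2 f P = vector [eval2 (map_poly pderiv f) P, eval2 (pderiv f) P]"

definition norm2 :: "'a::alg_closed_field ^ 2 \<Rightarrow> 'a" where
  "norm2 v = (SOME w. w\<^sup>2 = (v $ 1)\<^sup>2 + (v $ 2)\<^sup>2)"

definition offset :: "'a::alg_closed_field poly poly \<Rightarrow> 'a \<Rightarrow> ('a ^ 2) set" where
  "offset f d = zariski_closure
     ({P + (d / norm2 (grad2 f P)) *s grad2 f P | P.
         P \<in> plane_curve f \<and> norm2 (grad2 f P) \<noteq> 0} \<union>
      {P - (d / norm2 (grad2 f P)) *s grad2 f P | P.
         P \<in> plane_curve f \<and> norm2 (grad2 f P) \<noteq> 0})"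

end

theory Submission
  imports Defs
begin

text \<open>
  Let \<open>L\<close> be the algebraic closure of \<open>F(t)\<close>. A parametrization \<open>R\<close> of the curve \<open>f = 0\<close> is a pair
  of elements of \<open>L\<close>, and \<open>f(R) = 0\<close> holds in \<open>L\<close>: the values of \<open>f(R)\<close> vanish at almost all \<open>t0\<close>,
  whereas a nonzero element of \<open>L\<close> has an inverse that is defined at almost all \<open>t0\<close>
  (\<open>generic_point_on_zero_set\<close>). Write \<open>N\<close> for the value of \<open>f_x^2 + f_y^2\<close> at \<open>R\<close>. The two solutions
  \<open>w\<close> of \<open>w^2 N = d^2\<close> cost one further radical on top of the tower of \<open>R\<close>, and the new
  parametrizations are the nonconstant ones among the pairs \<open>Q = R + w \<nabla>f(R)\<close>. If the gradient is
  isotropic along the whole curve, then there is no such \<open>w\<close>, and the offset is empty as well.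
  Constant pairs do occur (the offset of a circle of radius \<open>d\<close> contains its centre), but each of
  them accounts for one point only.

  Let \<open>S\<close> be the set of the points \<open>P + \<omega> \<nabla>f(P)\<close> with \<open>f(P) = 0\<close> and \<open>\<omega>^2 |\<nabla>f(P)|^2 = d^2\<close>, so that the
  offset is the Zariski closure of \<open>S\<close>. The values of \<open>Q\<close> lie in \<open>S\<close> wherever \<open>R\<close> and \<open>w\<close> are defined,
  that is for almost all \<open>t0\<close>, hence every polynomial that vanishes on \<open>S\<close> vanishes at \<open>Q\<close>, and all
  values of \<open>Q\<close> lie in the offset (\<open>value_rf_offset_in_closure\<close>). Conversely, if \<open>P = R(t0)\<close>, then
  \<open>N\<close> has the value \<open>|\<nabla>f(P)|^2\<close> at \<open>t0\<close>, which is nonzero because \<open>d\<close> is; so both solutions \<open>w\<close> are defined at \<open>t0\<close>, and one of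
  them takes the value \<open>\<omega>\<close>, whatever place was chosen (\<open>offset_points_over_value\<close>). Thus the new
  parametrizations and finitely many points cover \<open>S\<close>.

  It remains to see that taking the closure adds only finitely many points. The closure of \<open>S\<close> is
  contained in a finite set together with the loci of the finitely many \<open>Q\<close>, where the locus of \<open>Q\<close> consists
  of the points at which every algebraic relation of \<open>Q\<close> holds. A point \<open>(a, b)\<close> of the locus is a ring
  homomorphism \<open>F[Q_1, Q_2] \<rightarrow> F\<close>. If it extends to the coordinates of \<open>R\<close> and to \<open>w\<close>, then the images of
  these elements show that \<open>(a, b)\<close> is in \<open>S\<close>. A homomorphism extends to every element that is a root of a
  polynomial whose leading coefficient is not mapped to zero, by the lying-over argument of
  \<open>local_extension\<close>. Since \<open>L\<close> is algebraic over \<open>F(Q_1)\<close> if \<open>Q_1\<close> is not constant (and otherwise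
  \<open>Q_2\<close> takes this part), only finitely many values \<open>a\<close> are bad, and over each of them the locus has
  only finitely many points (\<open>finite_nonlifting\<close>).
\<close>

(* In this theory the dollar sign always selects a component of a vector. *)
no_notation fps_nth (infixl \<open>$\<close> 75)

section \<open>Homomorphisms defined on a subring\<close>

abbreviation coeffs_in :: "'r::zero set \<Rightarrow> 'r poly \<Rightarrow> bool" where
  "coeffs_in A P \<equiv> \<forall>i. Polynomial.coeff P i \<in> A"

text \<open>
  The carrier \<open>A\<close> is a set because the homomorphisms below live on subrings of one field and are
  extended step by step; outside \<open>A\<close> the function \<open>\<phi>\<close> is arbitrary.
\<close>
locale subring_hom =
  fixes A :: "'r::comm_ring_1 set" and \<phi> :: "'r \<Rightarrow> 's::comm_ring_1"
  assumes one_mem: "1 \<in> A"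
    and uminus_mem: "x \<in> A \<Longrightarrow> - x \<in> A"
    and add_mem: "x \<in> A \<Longrightarrow> y \<in> A \<Longrightarrow> x + y \<in> A"
    and mult_mem: "x \<in> A \<Longrightarrow> y \<in> A \<Longrightarrow> x * y \<in> A"
    and hom_one: "\<phi> 1 = 1"
    and hom_add: "x \<in> A \<Longrightarrow> y \<in> A \<Longrightarrow> \<phi> (x + y) = \<phi> x + \<phi> y"
    and hom_mult: "x \<in> A \<Longrightarrow> y \<in> A \<Longrightarrow> \<phi> (x * y) = \<phi> x * \<phi> y"
begin

lemma zero_mem: "0 \<in> A"
  using add_mem[OF one_mem uminus_mem[OF one_mem]] by simp

lemma hom_zero: "\<phi> 0 = 0"
  using hom_add[OF zero_mem zero_mem] by simp

lemma hom_uminus: "x \<in> A \<Longrightarrow> \<phi> (- x) = - \<phi> x"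
  using hom_add[of x "- x"] uminus_mem by (simp add: hom_zero eq_neg_iff_add_eq_0 add.commute)

lemma diff_mem: "x \<in> A \<Longrightarrow> y \<in> A \<Longrightarrow> x - y \<in> A"
  using add_mem[of x "- y"] uminus_mem by simp

lemma hom_diff: "x \<in> A \<Longrightarrow> y \<in> A \<Longrightarrow> \<phi> (x - y) = \<phi> x - \<phi> y"
  using hom_add[of x "- y"] uminus_mem by (simp add: hom_uminus)

lemma power_mem: "x \<in> A \<Longrightarrow> x ^ n \<in> A"
  by (induction n) (simp_all add: one_mem mult_mem)

lemma hom_power: "x \<in> A \<Longrightarrow> \<phi> (x ^ n) = \<phi> x ^ n"
  by (induction n) (simp_all add: hom_one hom_mult power_mem)

lemma sum_mem: "(\<And>i. i \<in> I \<Longrightarrow> g i \<in> A) \<Longrightarrow> sum g I \<in> A"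
  by (induction I rule: infinite_finite_induct) (simp_all add: zero_mem add_mem)

lemma hom_sum: "(\<And>i. i \<in> I \<Longrightarrow> g i \<in> A) \<Longrightarrow> \<phi> (sum g I) = (\<Sum>i\<in>I. \<phi> (g i))"
  by (induction I rule: infinite_finite_induct) (simp_all add: hom_zero hom_add sum_mem)

lemma coeffs_in_pCons: "coeffs_in A (pCons c P) \<longleftrightarrow> c \<in> A \<and> coeffs_in A P"
  unfolding coeff_pCons by (auto split: nat.splits)

lemma poly_mem: "coeffs_in A P \<Longrightarrow> z \<in> A \<Longrightarrow> poly P z \<in> A"
  by (induction P) (simp_all add: zero_mem coeffs_in_pCons add_mem mult_mem)

lemma hom_poly: "coeffs_in A P \<Longrightarrow> z \<in> A \<Longrightarrow> \<phi> (poly P z) = poly (map_poly \<phi> P) (\<phi> z)"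
  by (induction P)
    (simp_all add: hom_zero coeffs_in_pCons map_poly_pCons hom_add hom_mult mult_mem poly_mem)

lemma coeffs_in_add: "coeffs_in A P \<Longrightarrow> coeffs_in A Q \<Longrightarrow> coeffs_in A (P + Q)"
  by (simp add: add_mem)

lemma coeffs_in_diff: "coeffs_in A P \<Longrightarrow> coeffs_in A Q \<Longrightarrow> coeffs_in A (P - Q)"
  by (simp add: diff_mem)

lemma coeffs_in_mult: "coeffs_in A P \<Longrightarrow> coeffs_in A Q \<Longrightarrow> coeffs_in A (P * Q)"
  by (simp add: coeff_mult sum_mem mult_mem)

lemma coeffs_in_monom: "c \<in> A \<Longrightarrow> coeffs_in A (monom c n)"
  by (simp add: zero_mem)

lemma map_poly_hom_add:
  "coeffs_in A P \<Longrightarrow> coeffs_in A Q \<Longrightarrow> map_poly \<phi> (P + Q) = map_poly \<phi> P + map_poly \<phi> Q"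
  by (rule poly_eqI) (simp add: hom_zero coeff_map_poly hom_add)

lemma map_poly_hom_diff:
  "coeffs_in A P \<Longrightarrow> coeffs_in A Q \<Longrightarrow> map_poly \<phi> (P - Q) = map_poly \<phi> P - map_poly \<phi> Q"
  by (rule poly_eqI) (simp add: hom_zero coeff_map_poly hom_diff)

lemma map_poly_hom_mult:
  "coeffs_in A P \<Longrightarrow> coeffs_in A Q \<Longrightarrow> map_poly \<phi> (P * Q) = map_poly \<phi> P * map_poly \<phi> Q"
  by (rule poly_eqI) (simp add: hom_zero coeff_map_poly coeff_mult hom_sum hom_mult mult_mem)

end

section \<open>Polynomials evaluated in the closure\<close>

lemma const_rf_0 [simp]: "const_rf 0 = 0"
  by (simp add: const_rf_def)

lemma const_rf_1 [simp]: "const_rf 1 = 1"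
  by (simp add: const_rf_def flip: one_pCons)

lemma const_rf_add: "const_rf (a + b) = const_rf a + const_rf b"
  and const_rf_mult: "const_rf (a * b) = const_rf a * const_rf b"
  and const_rf_uminus: "const_rf (- a) = - const_rf a"
  and const_rf_eq_iff [simp]: "const_rf a = const_rf b \<longleftrightarrow> a = b"
  for a b :: "'a::field"
proof -
  have add: "[:a + b:] = [:a:] + [:b:]" and mult: "[:a * b:] = [:a:] * [:b:]"
    and um: "[:- a:] = - [:a:]" for a b :: 'a
    by simp_all
  show "const_rf (a + b) = const_rf a + const_rf b" "const_rf (a * b) = const_rf a * const_rf b"
    "const_rf (- a) = - const_rf a"
    unfolding const_rf_def add mult um by (simp_all only: to_fract_add to_ac_add to_fract_mult
      to_ac_mult to_fract_uminus to_ac_minus)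
  show "const_rf a = const_rf b \<longleftrightarrow> a = b"
    by (simp add: const_rf_def)
qed

lemma const_rf_eq_0_iff [simp]: "const_rf c = 0 \<longleftrightarrow> c = 0"
  using const_rf_eq_iff[of c 0] by (simp del: const_rf_eq_iff)

interpretation const: subring_hom UNIV const_rf
  by unfold_locales (simp_all add: const_rf_add const_rf_mult)

definition rf_eval1 :: "'a::field poly \<Rightarrow> 'a ratfun_closure \<Rightarrow> 'a ratfun_closure" where
  "rf_eval1 p x = poly (map_poly const_rf p) x"

text \<open>
  As in \<open>eval2\<close>, the inner variable of \<open>h\<close> takes the first value and the outer one the second.
\<close>
definition rf_eval2 ::
  "'a::field poly poly \<Rightarrow> 'a ratfun_closure \<Rightarrow> 'a ratfun_closure \<Rightarrow> 'a ratfun_closure" where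
  "rf_eval2 h x y = poly (map_poly (\<lambda>c. rf_eval1 c x) h) y"

interpretation ev1: subring_hom UNIV "\<lambda>p. rf_eval1 p x" for x
  by unfold_locales
    (simp_all add: rf_eval1_def const.map_poly_hom_add const.map_poly_hom_mult)

declare ev1.hom_zero [simp] ev1.hom_one [simp]

interpretation ev2: subring_hom UNIV "\<lambda>h. rf_eval2 h x y" for x y
  by unfold_locales
    (simp_all add: rf_eval2_def ev1.map_poly_hom_add ev1.map_poly_hom_mult)

declare ev2.hom_zero [simp]

lemma rf_eval1_pCons [simp]: "rf_eval1 (pCons c p) x = const_rf c + x * rf_eval1 p x"
  by (simp add: rf_eval1_def map_poly_pCons)

lemma rf_eval2_pCons [simp]: "rf_eval2 (pCons c h) x y = rf_eval1 c x + y * rf_eval2 h x y"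
  by (simp add: rf_eval2_def map_poly_pCons)

lemma eval2_pCons: "eval2 (pCons c h) v = poly c (v $ 1) + v $ 2 * eval2 h v"
  by (simp add: eval2_def)

lemma eval2_0 [simp]: "eval2 0 v = 0"
  by (simp add: eval2_def)

lemma eval2_conv_poly: "eval2 h v = poly (map_poly (\<lambda>c. poly c (v $ 1)) h) (v $ 2)"
  by (induction h) (simp_all add: eval2_pCons map_poly_pCons)

lemma eval2_mult: "eval2 (h * k) v = eval2 h v * eval2 k v"
  by (simp add: eval2_def)

lemma rf_eval1_t_rf: "rf_eval1 p t_rf = to_ac (to_fract p)"
proof (induction p)
  case (pCons c p)
  have "pCons c p = [:c:] + [:0, 1:] * p"
    by simp
  then have "to_ac (to_fract (pCons c p)) = const_rf c + t_rf * to_ac (to_fract p)"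
    unfolding const_rf_def t_rf_def by (simp only: to_fract_add to_ac_add to_fract_mult to_ac_mult)
  with pCons.IH show ?case by simp
qed simp

text \<open>
  Over an algebraically closed field of constants \<open>p\<close> is a product of linear factors, and none of them
  vanishes at a nonconstant element. In other words, nonconstant elements are transcendental over \<open>F\<close>.
\<close>
lemma rf_eval1_nonzero:
  fixes x :: "'a::alg_closed_field ratfun_closure"
  assumes "x \<notin> range const_rf" "p \<noteq> 0"
  shows "rf_eval1 p x \<noteq> 0"
  using assms(2)
proof (induction "Polynomial.degree p" arbitrary: p)
  case 0
  then obtain c where "p = [:c:]" by (metis degree_eq_zeroE)
  with 0 show ?case by simp
next
  case (Suc n)
  then obtain r where "poly p r = 0"
    using alg_closed_imp_poly_has_root[of p] by auto
  then obtain q where q: "p = [:- r, 1:] * q"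
    by (auto simp: poly_eq_0_iff_dvd elim: dvdE)
  with Suc.prems have "q \<noteq> 0" by auto
  then have "Polynomial.degree p = Suc (Polynomial.degree q)"
    unfolding q by (subst degree_mult_eq) auto
  with Suc \<open>q \<noteq> 0\<close> have "rf_eval1 q x \<noteq> 0" by simp
  moreover have "x - const_rf r \<noteq> 0" using assms(1) by auto
  ultimately show ?case
    unfolding q ev1.hom_mult[OF UNIV_I UNIV_I] by (simp add: const_rf_uminus)
qed

lemma t_rf_nonconst: "t_rf \<notin> range (const_rf :: 'a::field \<Rightarrow> _)"
  by (auto simp: t_rf_def const_rf_def)

section \<open>Algebraic relations over the rational functions\<close>

lemma clear_denominators:
  fixes q :: "'b::idom fract poly"
  shows "\<exists>c p. c \<noteq> 0 \<and> map_poly to_fract p = smult (to_fract c) q"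
proof (induction q)
  case 0
  show ?case by (rule exI[of _ 1], rule exI[of _ 0]) simp
next
  case (pCons a q)
  then obtain c p where cp: "c \<noteq> 0" "map_poly to_fract p = smult (to_fract c) q" by auto
  obtain n m where a: "a = Fract n m" "m \<noteq> 0" by (cases a) auto
  have "map_poly to_fract (pCons (n * c) (smult m p)) = smult (to_fract (c * m)) (pCons a q)"
    using a cp by (simp add: map_poly_pCons map_poly_smult Fract_conv_to_fract mult.commute)
  moreover have "c * m \<noteq> 0" using cp a by simp
  ultimately show ?case by blast
qed

lemma algebraic_over_t:
  fixes S :: "'a::field ratfun_closure"
  obtains p where "p \<noteq> 0" "rf_eval2 p t_rf S = 0"
proof -
  obtain q :: "'a poly fract poly" where q: "q \<noteq> 0" "poly (map_poly to_ac q) S = 0"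
    by (rule alg_closure_algebraic)
  obtain c p where cp: "c \<noteq> 0" "map_poly to_fract p = smult (to_fract c) q"
    using clear_denominators by blast
  have "map_poly (\<lambda>c. rf_eval1 c t_rf) p = map_poly to_ac (map_poly to_fract p)"
    unfolding rf_eval1_t_rf by (simp add: map_poly_map_poly o_def)
  also have "\<dots> = smult (to_ac (to_fract c)) (map_poly to_ac q)"
    unfolding cp by (simp add: map_poly_smult)
  finally have "rf_eval2 p t_rf S = 0" unfolding rf_eval2_def by (simp add: q)
  moreover have "p \<noteq> 0" using cp q by auto
  ultimately show ?thesis using that by blast
qed

text \<open>
  If all coefficients of \<open>p\<close> vanish at \<open>a\<close>, then \<open>p\<close> is divisible by the polynomial \<open>x - a\<close> of the inner
  variable, which is nonzero at the transcendental element and can be divided out. Each division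
  lowers the degree of the leading coefficient. The relation obtained in this way stays nontrivial
  when the inner variable is set to \<open>a\<close>, so it leaves only finitely many values for the outer one.
\<close>
lemma relation_nonzero_at:
  fixes x :: "'a::alg_closed_field ratfun_closure"
  assumes x: "x \<notin> range const_rf" and "p \<noteq> 0" "rf_eval2 p x y = 0"
  obtains q where "map_poly (\<lambda>c. poly c a) q \<noteq> 0" "rf_eval2 q x y = 0"
proof -
  have "\<exists>q. map_poly (\<lambda>c. poly c a) q \<noteq> 0 \<and> rf_eval2 q x y = 0"
    using assms(2,3)
  proof (induction "Polynomial.degree (Polynomial.lead_coeff p)" arbitrary: p rule: less_induct)
    case less
    show ?case
    proof (cases "map_poly (\<lambda>c. poly c a) p = 0")
      case False
      with less.prems show ?thesis by blast
    next
      case True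
      define l where "l = [:- a, 1:]"
      define q where "q = map_poly (\<lambda>c. c div l) p"
      have cq: "Polynomial.coeff q i = Polynomial.coeff p i div l" for i
        unfolding q_def by (simp add: coeff_map_poly)
      have "l dvd Polynomial.coeff p i" for i
      proof -
        have "Polynomial.coeff (map_poly (\<lambda>c. poly c a) p) i = 0" using True by simp
        then show ?thesis by (simp add: coeff_map_poly l_def poly_eq_0_iff_dvd)
      qed
      then have ci: "Polynomial.coeff p i = l * Polynomial.coeff q i" for i
        by (simp add: cq)
      have p: "p = smult l q"
        by (rule poly_eqI) (simp add: ci)
      have l0: "l \<noteq> 0" by (simp add: l_def)
      have q0: "q \<noteq> 0" using less.prems p by auto
      have "Polynomial.degree p = Polynomial.degree q"
        using l0 by (simp add: p)
      then have "Polynomial.lead_coeff p = l * Polynomial.lead_coeff q"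
        by (simp add: ci)
      moreover have "Polynomial.degree l = 1" by (simp add: l_def)
      ultimately have
        "Polynomial.degree (Polynomial.lead_coeff q) < Polynomial.degree (Polynomial.lead_coeff p)"
        using l0 q0 by (simp add: degree_mult_eq)
      moreover have "rf_eval2 q x y = 0"
      proof -
        have "p = [:l:] * q" by (simp add: p)
        then have "rf_eval2 p x y = rf_eval1 l x * rf_eval2 q x y"
          using ev2.hom_mult[of "[:l:]" q] by simp
        then show ?thesis using less.prems rf_eval1_nonzero[OF x l0] by simp
      qed
      ultimately show ?thesis using less.hyps q0 by blast
    qed
  qed
  then show ?thesis using that by blast
qed

section \<open>Specializations\<close>

text \<open>
  A specialization gives values in \<open>F\<close> to the elements of a ring \<open>A\<close> with \<open>F \<subseteq> A \<subseteq> L\<close>, compatibly with all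
  polynomial relations over \<open>F\<close>. Both the evaluation at a place and the points of an affine curve are of this
  form.
\<close>
locale specialization = subring_hom A \<phi>
  for A :: "'a::field ratfun_closure set" and \<phi> :: "'a ratfun_closure \<Rightarrow> 'a" +
  assumes const_mem: "const_rf c \<in> A"
    and hom_const [simp]: "\<phi> (const_rf c) = c"
begin

declare hom_zero [simp] hom_one [simp]

lemma rf_eval1_mem: "x \<in> A \<Longrightarrow> rf_eval1 p x \<in> A"
  unfolding rf_eval1_def by (rule poly_mem) (simp_all add: coeff_map_poly const_mem)

lemma hom_rf_eval1: "x \<in> A \<Longrightarrow> \<phi> (rf_eval1 p x) = poly p (\<phi> x)"
  unfolding rf_eval1_def
  by (subst hom_poly) (simp_all add: coeff_map_poly const_mem map_poly_map_poly o_def)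

lemma rf_eval2_mem: "x \<in> A \<Longrightarrow> y \<in> A \<Longrightarrow> rf_eval2 h x y \<in> A"
  unfolding rf_eval2_def by (rule poly_mem) (simp_all add: coeff_map_poly rf_eval1_mem)

lemma hom_rf_eval2_poly:
  "x \<in> A \<Longrightarrow> y \<in> A \<Longrightarrow> \<phi> (rf_eval2 h x y) = poly (map_poly (\<lambda>c. poly c (\<phi> x)) h) (\<phi> y)"
  unfolding rf_eval2_def
  by (subst hom_poly)
    (simp_all add: coeff_map_poly rf_eval1_mem map_poly_map_poly o_def hom_rf_eval1)

lemma hom_rf_eval2:
  "x \<in> A \<Longrightarrow> y \<in> A \<Longrightarrow> v $ 1 = \<phi> x \<Longrightarrow> v $ 2 = \<phi> y \<Longrightarrow> \<phi> (rf_eval2 h x y) = eval2 h v"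
  by (simp add: hom_rf_eval2_poly eval2_conv_poly)

end

section \<open>Places as specializations\<close>

context
  fixes t0 :: "'a::alg_closed_field" and V :: "'a ratfun_closure set"
  assumes place: "place_at t0 V"
begin

lemma place_subring:
  shows place_zero: "0 \<in> V" and place_one: "1 \<in> V"
    and place_uminus: "x \<in> V \<Longrightarrow> - x \<in> V"
    and place_add: "x \<in> V \<Longrightarrow> y \<in> V \<Longrightarrow> x + y \<in> V"
    and place_mult: "x \<in> V \<Longrightarrow> y \<in> V \<Longrightarrow> x * y \<in> V"
proof -
  have V: "subring V ring_of_type_algebra"
    using place by (simp add: place_at_def)
  have "\<ominus>\<^bsub>ring_of_type_algebra\<^esub> x = - x" for x :: "'a ratfun_closure"
  proof -
    interpret R: ring "ring_of_type_algebra :: 'a ratfun_closure ring"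
      by (rule ring_from_type_algebra)
    show ?thesis
      by (rule R.minus_equality) (simp_all add: ring_of_type_algebra_def)
  qed
  with subringE(2,3,5-7)[OF V]
  show "0 \<in> V" "1 \<in> V" "x \<in> V \<Longrightarrow> - x \<in> V" "x \<in> V \<Longrightarrow> y \<in> V \<Longrightarrow> x + y \<in> V"
    "x \<in> V \<Longrightarrow> y \<in> V \<Longrightarrow> x * y \<in> V"
    by (simp_all add: ring_of_type_algebra_def)
qed

lemma place_valuation: "x \<in> V \<or> inverse x \<in> V"
    and place_const: "const_rf c \<in> V"
    and place_t: "t_rf - const_rf t0 \<in> val_max_ideal V"
proof -
  have P: "(\<forall>x. x \<in> V \<or> inverse x \<in> V) \<and> range const_rf \<subseteq> V \<and>
      t_rf - const_rf t0 \<in> val_max_ideal V"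
    using place unfolding place_at_def by (rule conjunct2)
  show "x \<in> V \<or> inverse x \<in> V" by (rule spec[OF conjunct1[OF P]])
  show "const_rf c \<in> V" by (rule subsetD[OF conjunct1[OF conjunct2[OF P]]]) (rule rangeI)
  show "t_rf - const_rf t0 \<in> val_max_ideal V" by (rule conjunct2[OF conjunct2[OF P]])
qed

interpretation id: subring_hom V "\<lambda>x. x"
  by unfold_locales (simp_all add: place_one place_uminus place_add place_mult)

lemma max_ideal_subset: "x \<in> val_max_ideal V \<Longrightarrow> x \<in> V"
  and max_ideal_zero: "0 \<in> val_max_ideal V"
  by (simp_all add: val_max_ideal_def place_zero)

lemma max_ideal_iff: "x \<in> val_max_ideal V \<longleftrightarrow> x \<in> V \<and> (x = 0 \<or> inverse x \<notin> V)"
  by (simp add: val_max_ideal_def)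

lemma max_ideal_mult:
  assumes x: "x \<in> val_max_ideal V" and y: "y \<in> V"
  shows "y * x \<in> val_max_ideal V"
proof (cases "y * x = 0")
  case True
  show ?thesis unfolding True by (rule max_ideal_zero)
next
  case False
  have "inverse (y * x) \<notin> V"
  proof
    assume "inverse (y * x) \<in> V"
    then have "y * inverse (y * x) \<in> V" by (rule place_mult[OF y])
    moreover have "y * inverse (y * x) = inverse x"
      using False by (metis inverse_unique mult.commute mult.left_commute right_inverse)
    ultimately have "inverse x \<in> V" by (simp only:)
    with x False show False unfolding max_ideal_iff by fastforce
  qed
  moreover have "y * x \<in> V" by (rule place_mult[OF y max_ideal_subset[OF x]])
  ultimately show ?thesis unfolding max_ideal_iff by blast
qed

lemma max_ideal_add:
  assumes x: "x \<in> val_max_ideal V" and y: "y \<in> val_max_ideal V"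
  shows "x + y \<in> val_max_ideal V"
proof (cases "x = 0 \<or> y = 0")
  case False
  have "x / y \<in> V \<or> y / x \<in> V"
    using place_valuation[of "x / y"] by simp
  then show ?thesis
  proof
    assume "x / y \<in> V"
    then have "(1 + x / y) * y \<in> val_max_ideal V"
      by (intro max_ideal_mult y place_add place_one)
    moreover have "(1 + x / y) * y = x + y" using False by (simp add: divide_simps)
    ultimately show ?thesis by (simp only:)
  next
    assume "y / x \<in> V"
    then have "(1 + y / x) * x \<in> val_max_ideal V"
      by (intro max_ideal_mult x place_add place_one)
    moreover have "(1 + y / x) * x = x + y" using False by (simp add: divide_simps)
    ultimately show ?thesis by (simp only:)
  qed
qed (use x y in auto)

lemma max_ideal_uminus: "x \<in> val_max_ideal V \<Longrightarrow> - x \<in> val_max_ideal V"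
  using max_ideal_mult[of x "- 1"] place_uminus[OF place_one] by simp

lemma max_ideal_diff: "x \<in> val_max_ideal V \<Longrightarrow> y \<in> val_max_ideal V \<Longrightarrow> x - y \<in> val_max_ideal V"
  using max_ideal_add[of x "- y"] max_ideal_uminus by simp

lemma max_ideal_prime:
  assumes "x \<in> V" "y \<in> V" "x * y \<in> val_max_ideal V"
  shows "x \<in> val_max_ideal V \<or> y \<in> val_max_ideal V"
  using assms place_mult[of "inverse x" "inverse y"] by (auto simp: val_max_ideal_def)

lemma max_ideal_const: "const_rf c \<in> val_max_ideal V \<longleftrightarrow> c = 0"
proof
  assume "const_rf c \<in> val_max_ideal V"
  moreover have "inverse (const_rf c) = const_rf (inverse c)" if "c \<noteq> 0"
    using const_rf_mult[of c "inverse c"] that by (simp add: inverse_unique)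
  ultimately show "c = 0"
    using place_const[of "inverse c"] unfolding max_ideal_iff by fastforce
qed (simp add: max_ideal_zero)

lemma residue_eqI:
  assumes "S - const_rf c \<in> val_max_ideal V"
  shows "residue V S = c"
  unfolding residue_def
proof (rule the_equality)
  fix c' assume "S - const_rf c' \<in> val_max_ideal V"
  from max_ideal_diff[OF this assms] have "const_rf (c - c') \<in> val_max_ideal V"
    using const_rf_add[of c "- c'"] by (simp add: const_rf_uminus)
  then show "c' = c" by (simp add: max_ideal_const)
qed (rule assms)

text \<open>
  The polynomial splits into linear factors, and the maximal ideal is prime.
\<close>
lemma linear_factor_in_max_ideal:
  assumes "S \<in> V" "p \<noteq> 0" "rf_eval1 p S \<in> val_max_ideal V"
  shows "\<exists>c. S - const_rf c \<in> val_max_ideal V"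
  using assms(2,3)
proof (induction "Polynomial.degree p" arbitrary: p)
  case 0
  then obtain c where "p = [:c:]" by (metis degree_eq_zeroE)
  with 0 show ?case by (simp add: max_ideal_const)
next
  case (Suc n)
  then obtain r where "poly p r = 0"
    using alg_closed_imp_poly_has_root[of p] by auto
  then obtain q where q: "p = [:- r, 1:] * q"
    by (auto simp: poly_eq_0_iff_dvd elim: dvdE)
  with Suc.prems have q0: "q \<noteq> 0" by auto
  then have "Polynomial.degree p = Suc (Polynomial.degree q)"
    unfolding q by (subst degree_mult_eq) auto
  then have deg: "n = Polynomial.degree q" using Suc.hyps(2) by simp
  have mem: "rf_eval1 q S \<in> V"
    unfolding rf_eval1_def using assms(1) by (intro id.poly_mem) (simp_all add: coeff_map_poly place_const)
  have "(S - const_rf r) * rf_eval1 q S \<in> val_max_ideal V"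
    using Suc.prems unfolding q ev1.hom_mult[OF UNIV_I UNIV_I] by (simp add: const_rf_uminus)
  then have "S - const_rf r \<in> val_max_ideal V \<or> rf_eval1 q S \<in> val_max_ideal V"
    by (intro max_ideal_prime id.diff_mem assms(1) place_const mem)
  then show ?case using Suc.hyps(1)[OF deg q0] by blast
qed

lemma place_t_mem: "t_rf \<in> V"
  using place_add[OF max_ideal_subset[OF place_t] place_const[of t0]] by simp

lemma place_rf_eval1_mem: "rf_eval1 c t_rf \<in> V"
  unfolding rf_eval1_def
  by (rule id.poly_mem) (simp_all add: coeff_map_poly place_const place_t_mem)

lemma rf_eval1_t_cong: "rf_eval1 c t_rf - const_rf (poly c t0) \<in> val_max_ideal V"
proof (induction c)
  case (pCons a c)
  have eq: "rf_eval1 (pCons a c) t_rf - const_rf (poly (pCons a c) t0) =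
    rf_eval1 c t_rf * (t_rf - const_rf t0) + const_rf t0 * (rf_eval1 c t_rf - const_rf (poly c t0))"
    by (simp add: const_rf_add const_rf_mult algebra_simps)
  show ?case
    unfolding eq
    by (intro max_ideal_add max_ideal_mult place_t pCons.IH place_const place_rf_eval1_mem)
qed (simp add: max_ideal_zero)

text \<open>
  Modulo the maximal ideal \<open>t\<close> may be replaced by \<open>t0\<close>.
\<close>
lemma rf_eval2_t_cong:
  assumes "S \<in> V"
  shows "rf_eval2 p t_rf S - rf_eval1 (map_poly (\<lambda>c. poly c t0) p) S \<in> val_max_ideal V"
proof (induction p)
  case (pCons a p)
  have eq: "rf_eval2 (pCons a p) t_rf S - rf_eval1 (map_poly (\<lambda>c. poly c t0) (pCons a p)) S =
    (rf_eval1 a t_rf - const_rf (poly a t0)) +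
    S * (rf_eval2 p t_rf S - rf_eval1 (map_poly (\<lambda>c. poly c t0) p) S)"
    by (simp add: map_poly_pCons algebra_simps)
  show ?case
    unfolding eq by (intro max_ideal_add max_ideal_mult rf_eval1_t_cong pCons.IH assms)
qed (simp add: max_ideal_zero)

text \<open>
  The residue field of a place is \<open>F\<close>: reduce an algebraic equation of \<open>S\<close> over \<open>F[t]\<close> that does not
  vanish identically at \<open>t0\<close>. The result is a nonzero polynomial over \<open>F\<close> that maps \<open>S\<close> into the maximal
  ideal.
\<close>
lemma residue_exists:
  assumes "S \<in> V"
  shows "S - const_rf (residue V S) \<in> val_max_ideal V"
proof -
  obtain p where "p \<noteq> 0" "rf_eval2 p t_rf S = 0"
    by (rule algebraic_over_t)
  then obtain q where q: "map_poly (\<lambda>c. poly c t0) q \<noteq> 0" "rf_eval2 q t_rf S = 0"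
    using relation_nonzero_at[OF t_rf_nonconst] by blast
  have "rf_eval1 (map_poly (\<lambda>c. poly c t0) q) S \<in> val_max_ideal V"
    using max_ideal_uminus[OF rf_eval2_t_cong[OF assms, of q]] q(2) by simp
  then obtain c where "S - const_rf c \<in> val_max_ideal V"
    using linear_factor_in_max_ideal[OF assms q(1)] by blast
  with residue_eqI[OF this] show ?thesis by simp
qed

lemma place_specialization: "specialization V (residue V)"
proof unfold_locales
  fix c show "residue V (const_rf c) = c" by (rule residue_eqI) (simp add: max_ideal_zero)
next
  show "residue V 1 = 1" by (rule residue_eqI) (simp add: max_ideal_zero)
next
  fix x y assume xy: "x \<in> V" "y \<in> V"
  let ?r = "residue V"
  have "x + y - const_rf (?r x + ?r y) = (x - const_rf (?r x)) + (y - const_rf (?r y))"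
    by (simp add: const_rf_add)
  then show "?r (x + y) = ?r x + ?r y"
    using xy by (intro residue_eqI) (simp only: max_ideal_add residue_exists)
  have "x * y - const_rf (?r x * ?r y) =
    y * (x - const_rf (?r x)) + const_rf (?r x) * (y - const_rf (?r y))"
    by (simp add: const_rf_mult algebra_simps)
  then show "?r (x * y) = ?r x * ?r y"
    using xy by (intro residue_eqI) (simp only: max_ideal_add max_ideal_mult residue_exists place_const)
qed (simp_all add: place_one place_uminus place_add place_mult place_const)

text \<open>
  Valuation rings are integrally closed. If \<open>S\<close> is not in \<open>V\<close>, then its inverse is, and the reversed
  equation, whose constant term is a unit, expresses \<open>S\<close> through that inverse.
\<close>
lemma integral_in_place:
  assumes G: "coeffs_in V G" "poly G S = 0"
    and unit: "Polynomial.lead_coeff G \<noteq> 0" "inverse (Polynomial.lead_coeff G) \<in> V"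
  shows "S \<in> V"
proof (rule ccontr)
  assume S: "S \<notin> V"
  then have u: "inverse S \<in> V" and S0: "S \<noteq> 0"
    using place_valuation[of S] place_zero by auto
  define H where "H = reflect_poly G"
  have H: "coeffs_in V H"
    using G(1) by (simp add: H_def coeff_reflect_poly place_zero)
  obtain c r where cr: "H = pCons c r" by (cases H)
  have c: "c = Polynomial.lead_coeff G"
    using coeff_0_reflect_poly[of G] by (simp add: cr flip: H_def)
  have r: "coeffs_in V r" using H by (simp add: cr id.coeffs_in_pCons)
  have "poly H (inverse S) = 0"
    using poly_reflect_poly_nz[of "inverse S" G] S0 G(2) by (simp add: H_def)
  then have "c + inverse S * poly r (inverse S) = 0" by (simp add: cr)
  then have "S * (c + inverse S * poly r (inverse S)) = 0" by simp
  then have "S * c + poly r (inverse S) = 0"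
    using S0 by (simp add: distrib_left flip: mult.assoc)
  then have "S = - poly r (inverse S) * inverse c"
    using unit c by (simp add: field_simps add_eq_0_iff)
  moreover have "- poly r (inverse S) * inverse c \<in> V"
    by (intro place_mult place_uminus id.poly_mem r u) (use unit c in simp)
  ultimately show False using S by simp
qed

end

text \<open>
  An equation for \<open>S\<close> over \<open>F[t]\<close> is integral at every \<open>t0\<close> at which its leading coefficient does not
  vanish.
\<close>
lemma finite_undefined:
  fixes S :: "'a::alg_closed_field ratfun_closure"
  assumes places: "\<And>t0. place_at t0 (pl t0)"
  shows "finite {t0. S \<notin> pl t0}"
proof -
  obtain p where p: "p \<noteq> 0" "rf_eval2 p t_rf S = 0"
    by (rule algebraic_over_t)
  define l where "l = Polynomial.lead_coeff p"
  have "l \<noteq> 0" using p by (simp add: l_def)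
  define G where "G = map_poly (\<lambda>c. rf_eval1 c t_rf) p"
  have l1: "rf_eval1 l t_rf \<noteq> 0"
    by (rule rf_eval1_nonzero[OF t_rf_nonconst \<open>l \<noteq> 0\<close>])
  then have lG: "Polynomial.lead_coeff G = rf_eval1 l t_rf"
    unfolding G_def l_def by (simp add: map_poly_degree_eq coeff_map_poly)
  have "S \<in> pl t0" if "poly l t0 \<noteq> 0" for t0
  proof (rule integral_in_place[OF places])
    show "coeffs_in (pl t0) G"
      by (simp add: G_def coeff_map_poly place_rf_eval1_mem[OF places])
    show "poly G S = 0" using p(2) by (simp add: G_def rf_eval2_def)
    show "Polynomial.lead_coeff G \<noteq> 0" using lG l1 by simp
    show "inverse (Polynomial.lead_coeff G) \<in> pl t0"
    proof (rule ccontr)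
      assume "\<not> ?thesis"
      then have "rf_eval1 l t_rf \<in> val_max_ideal (pl t0)"
        by (simp add: lG val_max_ideal_def place_rf_eval1_mem[OF places])
      then have "const_rf (poly l t0) \<in> val_max_ideal (pl t0)"
        using max_ideal_diff[OF places _ rf_eval1_t_cong[OF places, of l]] by fastforce
      then show False using max_ideal_const[OF places] that by simp
    qed
  qed
  then have "{t0. S \<notin> pl t0} \<subseteq> {t0. poly l t0 = 0}" by blast
  then show ?thesis by (rule finite_subset) (simp add: poly_roots_finite \<open>l \<noteq> 0\<close>)
qed

text \<open>
  If \<open>S\<close> is nonzero, then at almost all \<open>t0\<close> its inverse is defined too, and then the value of \<open>S\<close> is a
  unit.
\<close>
lemma zero_if_residues_vanish:
  fixes S :: "'a::alg_closed_field ratfun_closure"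
  assumes places: "\<And>t0. place_at t0 (pl t0)"
    and fin: "finite {t0. \<not> (S \<in> pl t0 \<and> residue (pl t0) S = 0)}"
    and inf: "infinite (UNIV :: 'a set)"
  shows "S = 0"
proof (rule ccontr)
  assume S: "S \<noteq> 0"
  have "finite ({t0. \<not> (S \<in> pl t0 \<and> residue (pl t0) S = 0)} \<union> {t0. inverse S \<notin> pl t0})"
    using fin finite_undefined[of pl, OF places] by simp
  then obtain t0 where t0: "S \<in> pl t0" "residue (pl t0) S = 0" "inverse S \<in> pl t0"
    using inf by (metis (mono_tags, lifting) UnCI ex_new_if_finite mem_Collect_eq)
  interpret specialization "pl t0" "residue (pl t0)"
    by (rule place_specialization[OF places])
  have "residue (pl t0) (S * inverse S) = 0"
    using t0 by (simp add: hom_mult)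
  with S show False by simp
qed

section \<open>Extending a specialization\<close>

definition extends_spec ::
  "'a::field ratfun_closure set \<Rightarrow> ('a ratfun_closure \<Rightarrow> 'a) \<Rightarrow>
   'a ratfun_closure set \<Rightarrow> ('a ratfun_closure \<Rightarrow> 'a) \<Rightarrow> bool" where
  "extends_spec A \<phi> B \<psi> \<longleftrightarrow> specialization B \<psi> \<and> A \<subseteq> B \<and> (\<forall>x\<in>A. \<psi> x = \<phi> x)"

lemma extends_spec_trans:
  "extends_spec A \<phi> B \<psi> \<Longrightarrow> extends_spec B \<psi> C \<omega> \<Longrightarrow> extends_spec A \<phi> C \<omega>"
  unfolding extends_spec_def by (metis subsetD subset_trans)

context specialization
begin

lemma localization:
  obtains B \<psi> where "extends_spec A \<phi> B \<psi>" "\<And>x. x \<in> B \<Longrightarrow> \<psi> x \<noteq> 0 \<Longrightarrow> inverse x \<in> B"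
proof -
  define B where "B = {a / b |a b. a \<in> A \<and> b \<in> A \<and> \<phi> b \<noteq> 0}"
  define \<psi> where "\<psi> x = (THE v. \<exists>a b. a \<in> A \<and> b \<in> A \<and> \<phi> b \<noteq> 0 \<and> x = a / b \<and> v = \<phi> a / \<phi> b)" for x
  have nz: "b \<noteq> 0" if "\<phi> b \<noteq> 0" for b using that by auto
  have memI: "a / b \<in> B" if "a \<in> A" "b \<in> A" "\<phi> b \<noteq> 0" for a b
    using that unfolding B_def by blast
  have \<psi>: "\<psi> (a / b) = \<phi> a / \<phi> b" if ab: "a \<in> A" "b \<in> A" "\<phi> b \<noteq> 0" for a b
    unfolding \<psi>_def
  proof (rule the_equality)
    fix v assume "\<exists>a' b'. a' \<in> A \<and> b' \<in> A \<and> \<phi> b' \<noteq> 0 \<and> a / b = a' / b' \<and> v = \<phi> a' / \<phi> b'"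
    then obtain a' b' where ab': "a' \<in> A" "b' \<in> A" "\<phi> b' \<noteq> 0" "a / b = a' / b'" "v = \<phi> a' / \<phi> b'"
      by blast
    from ab'(4) have "a * b' = a' * b"
      using nz[OF ab(3)] nz[OF ab'(3)] by (simp add: frac_eq_eq)
    then have "\<phi> a * \<phi> b' = \<phi> a' * \<phi> b"
      using ab ab' by (metis hom_mult)
    then show "v = \<phi> a / \<phi> b"
      using ab ab' by (simp add: frac_eq_eq)
  qed (use ab in blast)
  have incl: "a \<in> B" "\<psi> a = \<phi> a" if "a \<in> A" for a
    using memI[OF that one_mem] \<psi>[OF that one_mem] by simp_all
  have elim: "\<exists>a b. a \<in> A \<and> b \<in> A \<and> \<phi> b \<noteq> 0 \<and> x = a / b" if "x \<in> B" for x
    using that unfolding B_def by blast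
  have "specialization B \<psi>"
  proof
    fix x y assume "x \<in> B" "y \<in> B"
    then obtain a b c d where x: "a \<in> A" "b \<in> A" "\<phi> b \<noteq> 0" "x = a / b"
      and y: "c \<in> A" "d \<in> A" "\<phi> d \<noteq> 0" "y = c / d"
      by (meson elim)
    have bd: "b * d \<in> A" "\<phi> (b * d) \<noteq> 0"
      using x y by (simp_all add: mult_mem hom_mult)
    have add: "x + y = (a * d + c * b) / (b * d)" and mult: "x * y = (a * c) / (b * d)"
      using nz x y by (simp_all add: add_frac_eq)
    have adcb: "a * d + c * b \<in> A" "a * c \<in> A" using x y by (simp_all add: add_mem mult_mem)
    show "x + y \<in> B" "x * y \<in> B"
      unfolding add mult by (intro memI bd adcb)+
    show "\<psi> (x + y) = \<psi> x + \<psi> y"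
      unfolding add \<psi>[OF adcb(1) bd] unfolding x(4) y(4) \<psi>[OF x(1-3)] \<psi>[OF y(1-3)]
      using x y by (simp add: hom_add hom_mult mult_mem add_frac_eq)
    show "\<psi> (x * y) = \<psi> x * \<psi> y"
      unfolding mult \<psi>[OF adcb(2) bd] unfolding x(4) y(4) \<psi>[OF x(1-3)] \<psi>[OF y(1-3)]
      using x y by (simp add: hom_mult)
  next
    fix x assume "x \<in> B"
    then obtain a b where x: "a \<in> A" "b \<in> A" "\<phi> b \<noteq> 0" "x = a / b" by (meson elim)
    show "- x \<in> B"
      using memI[OF uminus_mem[OF x(1)] x(2,3)] x(4) by simp
  qed (use incl one_mem const_mem in simp_all)
  moreover have "inverse x \<in> B" if "x \<in> B" "\<psi> x \<noteq> 0" for x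
  proof -
    obtain a b where x: "a \<in> A" "b \<in> A" "\<phi> b \<noteq> 0" "x = a / b" using \<open>x \<in> B\<close> by (meson elim)
    then have "\<phi> a \<noteq> 0" using that(2) \<psi>[OF x(1-3)] by auto
    then have "b / a \<in> B" using memI x by blast
    then show ?thesis using x(4) by simp
  qed
  ultimately show ?thesis
    using that[of B \<psi>] incl unfolding extends_spec_def by blast
qed

lemma division_in_subring:
  assumes G: "coeffs_in A G" "Polynomial.lead_coeff G \<noteq> 0" "inverse (Polynomial.lead_coeff G) \<in> A"
    and P: "coeffs_in A P"
  obtains Q R where "coeffs_in A Q" "coeffs_in A R" "P = Q * G + R"
    "\<And>i. Polynomial.degree G \<le> i \<Longrightarrow> Polynomial.coeff R i = 0"
proof -
  let ?n = "Polynomial.degree G"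
  have "\<exists>Q R. coeffs_in A Q \<and> coeffs_in A R \<and> P = Q * G + R \<and> (\<forall>i\<ge>?n. Polynomial.coeff R i = 0)"
    if "coeffs_in A P" "\<forall>i\<ge>m. Polynomial.coeff P i = 0" for m
    using that
  proof (induction m arbitrary: P)
    case 0
    then have "P = 0" by (intro poly_eqI) simp
    then show ?case by (intro exI[of _ 0]) (simp add: zero_mem)
  next
    case (Suc m)
    show ?case
    proof (cases "m < ?n")
      case True
      then show ?thesis
        using Suc.prems by (intro exI[of _ 0] exI[of _ P]) (auto simp: zero_mem)
    next
      case False
      define M where "M = monom (Polynomial.coeff P m * inverse (Polynomial.lead_coeff G)) (m - ?n)"
      have M: "coeffs_in A M"
        unfolding M_def using Suc.prems(1) G(3) by (intro coeffs_in_monom mult_mem) simp_all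
      have "coeffs_in A (P - M * G)"
        by (rule coeffs_in_diff[OF Suc.prems(1) coeffs_in_mult[OF M G(1)]])
      moreover have "Polynomial.coeff (P - M * G) i = 0" if "m \<le> i" for i
      proof (cases "i = m")
        case True
        then show ?thesis using False G(2) by (simp add: M_def coeff_monom_mult)
      next
        case neq: False
        then have "Polynomial.coeff P i = 0" using Suc.prems(2) that by simp
        moreover have "?n < i - (m - ?n)" using neq that False by linarith
        ultimately show ?thesis by (simp add: M_def coeff_monom_mult coeff_eq_0)
      qed
      ultimately obtain Q R where "coeffs_in A Q" "coeffs_in A R" "P - M * G = Q * G + R"
        "\<forall>i\<ge>?n. Polynomial.coeff R i = 0"
        using Suc.IH by blast
      moreover from this have "P = (Q + M) * G + R" by (simp add: algebra_simps)
      ultimately show ?thesis using coeffs_in_add[OF _ M] by blast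
    qed
  qed
  from this[OF P, of "Suc (Polynomial.degree P)"]
  obtain Q R where "coeffs_in A Q \<and> coeffs_in A R \<and> P = Q * G + R \<and>
      (\<forall>i\<ge>?n. Polynomial.coeff R i = 0)"
    by (auto simp: coeff_eq_0)
  then show ?thesis using that by blast
qed

end

text \<open>
  Lying over, for one generator \<open>z\<close>. The extension must send \<open>z\<close> to a common root of the reductions
  \<open>\<phi> P\<close> of all polynomials \<open>P\<close> over \<open>A\<close> with \<open>P(z) = 0\<close>. Choose such a polynomial \<open>G\<close> with unit leading
  coefficient and with minimal degree \<open>n\<close>. No relation of degree below \<open>n\<close> has a nonzero reduction: a
  reduction of degree \<open>j < n\<close> could be shifted to degree \<open>n - 1\<close> by multiplying the relation with a power of
  the variable, and the remainder modulo \<open>G\<close> would be a relation of degree \<open>n - 1\<close> with unit leading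
  coefficient. This replaces Nakayama's lemma. So every reduction is a multiple of that of
  \<open>G\<close>, and any root of the latter will do.
\<close>
lemma local_extension:
  fixes A :: "'a::alg_closed_field ratfun_closure set"
  assumes spec: "specialization A \<phi>"
    and local: "\<And>x. x \<in> A \<Longrightarrow> \<phi> x \<noteq> 0 \<Longrightarrow> inverse x \<in> A"
    and G0: "coeffs_in A G0" "poly G0 z = 0" "\<phi> (Polynomial.lead_coeff G0) \<noteq> 0"
  obtains B \<psi> where "extends_spec A \<phi> B \<psi>" "z \<in> B"
proof -
  interpret specialization A \<phi> by (rule spec)
  define rel where "rel P \<longleftrightarrow> coeffs_in A P \<and> poly P z = 0" for P
  define good where
    "good n \<longleftrightarrow> (\<exists>G. rel G \<and> Polynomial.degree G = n \<and> \<phi> (Polynomial.lead_coeff G) \<noteq> 0)" for n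
  have "good (Polynomial.degree G0)" using G0 unfolding good_def rel_def by blast
  define n where "n = (LEAST n. good n)"
  have "good n" unfolding n_def by (rule LeastI) fact
  have least: "n \<le> m" if "good m" for m unfolding n_def by (rule Least_le) fact
  obtain G where G: "rel G" "Polynomial.degree G = n" "\<phi> (Polynomial.lead_coeff G) \<noteq> 0"
    using \<open>good n\<close> unfolding good_def by blast
  have GA: "coeffs_in A G" and Gz: "poly G z = 0" using G(1) by (simp_all add: rel_def)
  have lG: "Polynomial.lead_coeff G \<noteq> 0" using G(3) by auto
  have lG': "inverse (Polynomial.lead_coeff G) \<in> A"
    by (rule local) (use GA G(3) in simp_all)
  define g where "g = map_poly \<phi> G"
  have dg: "Polynomial.degree g = n"
    unfolding g_def using map_poly_degree_eq[of \<phi> G, OF G(3)] G(2) by simp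
  have g0: "g \<noteq> 0"
    using G(3) by (auto simp: g_def coeff_map_poly dest!: arg_cong[of _ 0 "\<lambda>p. Polynomial.coeff p (Polynomial.degree G)"])
  have n: "n > 0"
  proof (rule ccontr)
    assume "\<not> n > 0"
    then obtain c where "G = [:c:]" using G(2) by (metis degree_eq_zeroE gr0I)
    with Gz lG show False by simp
  qed
  have reduce: "\<exists>Q R. coeffs_in A Q \<and> rel R \<and> map_poly \<phi> P = map_poly \<phi> Q * g + map_poly \<phi> R
      \<and> (\<forall>i\<ge>n. Polynomial.coeff R i = 0)" if "rel P" for P
  proof -
    have P: "coeffs_in A P" "poly P z = 0" using that by (simp_all add: rel_def)
    obtain Q R where QR: "coeffs_in A Q" "coeffs_in A R" "P = Q * G + R"
        "\<And>i. n \<le> i \<Longrightarrow> Polynomial.coeff R i = 0"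
      using division_in_subring[OF GA lG lG' P(1)] G(2) by metis
    have "rel R" using QR P Gz by (simp add: rel_def)
    moreover have "map_poly \<phi> P = map_poly \<phi> Q * g + map_poly \<phi> R"
      unfolding QR(3) g_def
      by (simp only: map_poly_hom_add[OF coeffs_in_mult[OF QR(1) GA] QR(2)] map_poly_hom_mult[OF QR(1) GA])
    ultimately show ?thesis using QR by blast
  qed
  \<comment> \<open>the minimality of \<open>n\<close>, as explained above\<close>
  have low_degree: "map_poly \<phi> P = 0" if P: "rel P" "\<And>i. n \<le> i \<Longrightarrow> Polynomial.coeff P i = 0" for P
  proof (rule ccontr)
    define p where "p = map_poly \<phi> P"
    define j where "j = Polynomial.degree p"
    assume "map_poly \<phi> P \<noteq> 0"
    then have pj: "Polynomial.coeff p j \<noteq> 0" unfolding p_def j_def by simp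
    have "Polynomial.coeff p i = 0" if "n \<le> i" for i
      using P(2)[OF that] by (simp add: p_def coeff_map_poly)
    with pj have jn: "j < n" by (meson not_le)
    define P1 where "P1 = monom 1 (n - 1 - j) * P"
    have "coeffs_in A P1" "poly P1 z = 0"
      using P(1) coeffs_in_mult[OF coeffs_in_monom[OF one_mem], of P]
      unfolding rel_def P1_def by simp_all
    then have "rel P1" by (simp add: rel_def)
    have p1: "map_poly \<phi> P1 = monom 1 (n - 1 - j) * p"
      unfolding P1_def p_def using P(1)
      by (subst map_poly_hom_mult) (auto simp: rel_def zero_mem one_mem map_poly_monom)
    obtain Q R where QR: "rel R" "map_poly \<phi> P1 = map_poly \<phi> Q * g + map_poly \<phi> R"
        "\<And>i. n \<le> i \<Longrightarrow> Polynomial.coeff R i = 0"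
      using reduce[OF \<open>rel P1\<close>] by blast
    have "map_poly \<phi> Q = 0"
    proof (rule ccontr)
      assume q: "map_poly \<phi> Q \<noteq> 0"
      define k where "k = Polynomial.degree (map_poly \<phi> Q)"
      have "Polynomial.coeff (map_poly \<phi> Q * g) (k + n) \<noteq> 0"
        unfolding k_def using q g0 by (simp add: coeff_mult_degree_sum flip: dg)
      moreover have "Polynomial.coeff (map_poly \<phi> R) (k + n) = 0"
        using QR(3)[of "k + n"] by (simp add: coeff_map_poly)
      moreover have "Polynomial.coeff (map_poly \<phi> P1) (k + n) = 0"
        unfolding p1 using jn by (simp add: coeff_monom_mult coeff_eq_0 j_def)
      ultimately show False using QR(2) by simp
    qed
    then have "map_poly \<phi> R = monom 1 (n - 1 - j) * p" using QR(2) p1 by simp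
    then have "Polynomial.coeff (map_poly \<phi> R) (n - 1) = Polynomial.coeff p j"
      using jn by (simp add: coeff_monom_mult)
    with pj have R: "\<phi> (Polynomial.coeff R (n - 1)) \<noteq> 0" by (simp add: coeff_map_poly)
    then have "Polynomial.coeff R (n - 1) \<noteq> 0" by auto
    moreover have "Polynomial.coeff R i = 0" if "n - 1 < i" for i
      using QR(3)[of i] that by simp
    ultimately have "Polynomial.degree R = n - 1"
      by (meson le_degree degree_le le_antisym)
    with R QR(1) have "good (n - 1)" unfolding good_def by metis
    from least[OF this] n show False by simp
  qed
  obtain \<zeta> where \<zeta>: "poly g \<zeta> = 0"
    using alg_closed_imp_poly_has_root[of g] n dg by auto
  have root: "poly (map_poly \<phi> P) \<zeta> = 0" if P: "rel P" for P
  proof -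
    obtain Q R where QR: "rel R" "map_poly \<phi> P = map_poly \<phi> Q * g + map_poly \<phi> R"
        "\<And>i. n \<le> i \<Longrightarrow> Polynomial.coeff R i = 0"
      using reduce[OF P] by blast
    have "map_poly \<phi> R = 0" by (rule low_degree) (use QR in auto)
    with QR(2) \<zeta> show ?thesis by simp
  qed
  define B where "B = {poly P z |P. coeffs_in A P}"
  define \<psi> where
    "\<psi> x = (THE v. \<exists>P. coeffs_in A P \<and> x = poly P z \<and> v = poly (map_poly \<phi> P) \<zeta>)" for x
  have memI: "poly P z \<in> B" if "coeffs_in A P" for P
    using that unfolding B_def by blast
  have elim: "\<exists>P. coeffs_in A P \<and> x = poly P z" if "x \<in> B" for x
    using that unfolding B_def by blast
  have \<psi>: "\<psi> (poly P z) = poly (map_poly \<phi> P) \<zeta>" if P: "coeffs_in A P" for P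
    unfolding \<psi>_def
  proof (rule the_equality)
    fix v assume "\<exists>P'. coeffs_in A P' \<and> poly P z = poly P' z \<and> v = poly (map_poly \<phi> P') \<zeta>"
    then obtain P' where P': "coeffs_in A P'" "poly P z = poly P' z" "v = poly (map_poly \<phi> P') \<zeta>"
      by blast
    have "rel (P - P')" unfolding rel_def using coeffs_in_diff[OF P P'(1)] P'(2) by simp
    from root[OF this] show "v = poly (map_poly \<phi> P) \<zeta>"
      unfolding map_poly_hom_diff[OF P P'(1)] P'(3) by simp
  qed (use P in blast)
  have const: "a \<in> B" "\<psi> a = \<phi> a" if "a \<in> A" for a
  proof -
    have *: "coeffs_in A [:a:]" using that by (simp add: coeffs_in_pCons zero_mem)
    show "a \<in> B" "\<psi> a = \<phi> a"
      using memI[OF *] \<psi>[OF *] by (simp_all add: map_poly_pCons)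
  qed
  have "specialization B \<psi>"
  proof
    fix x y assume "x \<in> B" "y \<in> B"
    then obtain P Q where P: "coeffs_in A P" "x = poly P z" and Q: "coeffs_in A Q" "y = poly Q z"
      by (meson elim)
    note add = coeffs_in_add[OF P(1) Q(1)] and mult = coeffs_in_mult[OF P(1) Q(1)]
    show "x + y \<in> B" "x * y \<in> B"
      using memI[OF add] memI[OF mult] P(2) Q(2) by simp_all
    show "\<psi> (x + y) = \<psi> x + \<psi> y" "\<psi> (x * y) = \<psi> x * \<psi> y"
      using \<psi>[OF add] \<psi>[OF mult] \<psi>[OF P(1)] \<psi>[OF Q(1)] P(2) Q(2)
      by (simp_all add: map_poly_hom_add[OF P(1) Q(1)] map_poly_hom_mult[OF P(1) Q(1)])
  next
    fix x assume "x \<in> B"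
    then obtain P where P: "coeffs_in A P" "x = poly P z" by (meson elim)
    have "coeffs_in A (- P)" using P(1) by (simp add: uminus_mem)
    from memI[OF this] show "- x \<in> B" using P(2) by simp
  qed (use const one_mem const_mem in simp_all)
  moreover have "z \<in> B"
  proof -
    have "coeffs_in A [:0, 1:]" by (simp add: coeffs_in_pCons zero_mem one_mem)
    from memI[OF this] show ?thesis by simp
  qed
  ultimately show ?thesis
    using that[of B \<psi>] const unfolding extends_spec_def by blast
qed

text \<open>
  Passing to the fractions whose denominators are not mapped to zero turns the leading coefficient into
  a unit.
\<close>
lemma extension_to_root:
  fixes A :: "'a::alg_closed_field ratfun_closure set"
  assumes spec: "specialization A \<phi>"
    and G: "coeffs_in A G" "poly G z = 0" "\<phi> (Polynomial.lead_coeff G) \<noteq> 0"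
  obtains B \<psi> where "extends_spec A \<phi> B \<psi>" "z \<in> B"
proof -
  obtain C \<omega> where C: "extends_spec A \<phi> C \<omega>"
      and local: "\<And>x. x \<in> C \<Longrightarrow> \<omega> x \<noteq> 0 \<Longrightarrow> inverse x \<in> C"
    using specialization.localization[OF spec] by blast
  have C': "specialization C \<omega>" "A \<subseteq> C" "\<And>x. x \<in> A \<Longrightarrow> \<omega> x = \<phi> x"
    using C by (auto simp: extends_spec_def)
  obtain B \<psi> where "extends_spec C \<omega> B \<psi>" "z \<in> B"
    by (rule local_extension[OF C'(1) local _ G(2)]) (use G C' in auto)
  then show ?thesis using that extends_spec_trans[OF C] by blast
qed

text \<open>
  For an element that is algebraic over \<open>F[x]\<close>, the condition on the leading coefficient is a condition on
  the value of \<open>x\<close>.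
\<close>
lemma extension_to_algebraic:
  fixes A :: "'a::alg_closed_field ratfun_closure set"
  assumes spec: "specialization A \<phi>" and x: "x \<in> A" and q: "rf_eval2 q x z = 0"
    and unit: "poly (Polynomial.lead_coeff q) (\<phi> x) \<noteq> 0"
  obtains B \<psi> where "extends_spec A \<phi> B \<psi>" "z \<in> B"
proof -
  interpret specialization A \<phi> by (rule spec)
  define G where "G = map_poly (\<lambda>c. rf_eval1 c x) q"
  have u: "\<phi> (rf_eval1 (Polynomial.lead_coeff q) x) \<noteq> 0"
    using unit by (simp add: hom_rf_eval1[OF x])
  then have "rf_eval1 (Polynomial.lead_coeff q) x \<noteq> 0" by auto
  then have "Polynomial.lead_coeff G = rf_eval1 (Polynomial.lead_coeff q) x"
    by (simp add: G_def map_poly_degree_eq coeff_map_poly)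
  with u have "\<phi> (Polynomial.lead_coeff G) \<noteq> 0" by simp
  moreover have "coeffs_in A G" by (simp add: G_def coeff_map_poly rf_eval1_mem[OF x])
  moreover have "poly G z = 0" using q by (simp add: G_def rf_eval2_def)
  ultimately show ?thesis using extension_to_root[OF spec] that by blast
qed

lemma extension_over_t:
  fixes zs :: "'a::alg_closed_field ratfun_closure set"
  assumes "finite zs"
  obtains T where "finite T"
    "\<And>A \<phi>. specialization A \<phi> \<Longrightarrow> t_rf \<in> A \<Longrightarrow> \<phi> t_rf \<notin> T \<Longrightarrow>
      \<exists>B \<psi>. extends_spec A \<phi> B \<psi> \<and> zs \<subseteq> B"
proof -
  have "\<exists>T. finite T \<and> (\<forall>A \<phi>. specialization A \<phi> \<longrightarrow> t_rf \<in> A \<longrightarrow> \<phi> t_rf \<notin> T \<longrightarrow>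
      (\<exists>B \<psi>. extends_spec A \<phi> B \<psi> \<and> zs \<subseteq> B))"
    using assms
  proof (induction zs rule: finite_induct)
    case empty
    show ?case by (rule exI[of _ "{}"]) (auto simp: extends_spec_def)
  next
    case (insert z zs)
    then obtain T where T: "finite T" "\<And>A \<phi>. specialization A \<phi> \<Longrightarrow> t_rf \<in> A \<Longrightarrow> \<phi> t_rf \<notin> T \<Longrightarrow>
        \<exists>B \<psi>. extends_spec A \<phi> B \<psi> \<and> zs \<subseteq> B"
      by blast
    obtain q where q: "q \<noteq> 0" "rf_eval2 q t_rf z = 0" by (rule algebraic_over_t)
    define T' where "T' = T \<union> {c. poly (Polynomial.lead_coeff q) c = 0}"
    have "finite T'" using T(1) q(1) by (simp add: T'_def poly_roots_finite)
    moreover have "\<exists>B \<psi>. extends_spec A \<phi> B \<psi> \<and> insert z zs \<subseteq> B"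
      if A: "specialization A \<phi>" "t_rf \<in> A" "\<phi> t_rf \<notin> T'" for A \<phi>
    proof -
      obtain C \<omega> where C: "extends_spec A \<phi> C \<omega>" "zs \<subseteq> C"
        using T(2)[OF A(1,2)] A(3) by (auto simp: T'_def)
      have C': "specialization C \<omega>" "t_rf \<in> C" "\<omega> t_rf = \<phi> t_rf"
        using C(1) A(2) by (auto simp: extends_spec_def)
      have "poly (Polynomial.lead_coeff q) (\<omega> t_rf) \<noteq> 0"
        using A(3) C'(3) by (simp add: T'_def)
      then obtain B \<psi> where B: "extends_spec C \<omega> B \<psi>" "z \<in> B"
        using extension_to_algebraic[OF C'(1,2) q(2)] by blast
      then have "insert z zs \<subseteq> B" using C(2) by (auto simp: extends_spec_def)
      then show ?thesis using extends_spec_trans[OF C(1) B(1)] by blast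
    qed
    ultimately show ?case by blast
  qed
  then show ?thesis using that by blast
qed

section \<open>Almost every specialization extends\<close>

text \<open>
  The polynomial with its two variables exchanged.
\<close>
definition swap_poly :: "'a::comm_ring_1 poly poly \<Rightarrow> 'a poly poly" where
  "swap_poly p = poly (map_poly (map_poly (\<lambda>a. [:a:])) p) [:[:0, 1:]:]"

lemma swap_poly_pCons:
  "swap_poly (pCons c p) = map_poly (\<lambda>a. [:a:]) c + Polynomial.smult [:0, 1:] (swap_poly p)"
  by (simp add: swap_poly_def map_poly_pCons)

lemma coeff_swap_poly:
  "Polynomial.coeff (Polynomial.coeff (swap_poly p) j) i = Polynomial.coeff (Polynomial.coeff p i) j"
proof (induction p arbitrary: i)
  case 0
  show ?case by (simp add: swap_poly_def)
next
  case (pCons c p)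
  then show ?case
    by (cases i) (simp_all add: swap_poly_pCons coeff_map_poly)
qed

lemma swap_poly_nonzero:
  assumes "p \<noteq> 0" shows "swap_poly p \<noteq> 0"
proof
  assume "swap_poly p = 0"
  then have "Polynomial.coeff (Polynomial.coeff p i) j = 0" for i j
    using coeff_swap_poly[of p j i] by simp
  then have "p = 0" by (intro poly_eqI) simp
  with assms show False by simp
qed

lemma rf_eval2_swap_poly: "rf_eval2 (swap_poly p) x y = rf_eval2 p y x"
proof (induction p)
  case 0
  show ?case by (simp add: swap_poly_def)
next
  case (pCons c p)
  have c: "rf_eval2 (map_poly (\<lambda>a. [:a:]) c) x y = rf_eval1 c y"
    by (induction c) (simp_all add: map_poly_pCons)
  have "Polynomial.smult [:0, 1:] q = [:[:0, 1:]:] * q" for q :: "'a poly poly" by simp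
  then have "rf_eval2 (Polynomial.smult [:0, 1:] q) x y = x * rf_eval2 q x y" for q
    using ev2.hom_mult[of "[:[:0, 1:]:]" q x y] by simp
  then show ?case
    using pCons.IH by (simp add: swap_poly_pCons ev2.hom_add c)
qed

lemma t_algebraic_over:
  fixes x :: "'a::field ratfun_closure"
  obtains s where "s \<noteq> 0" "rf_eval2 s x t_rf = 0"
  using algebraic_over_t[of x] swap_poly_nonzero rf_eval2_swap_poly by metis

text \<open>
  Adjoin first \<open>t\<close>, by an equation between \<open>x\<close> and \<open>t\<close> whose leading coefficient is in \<open>F[x]\<close>, and then the
  given elements, which are algebraic over \<open>F[t]\<close>. The second step excludes finitely many values of \<open>t\<close>; by another such equation each of them
  excludes only finitely many values of \<open>x\<close>.
\<close>
lemma extension_outside_finite: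
  fixes x :: "'a::alg_closed_field ratfun_closure"
  assumes "finite zs"
  obtains E where "finite E"
    "\<And>A \<phi>. specialization A \<phi> \<Longrightarrow> x \<in> A \<Longrightarrow> \<phi> x \<notin> E \<Longrightarrow>
      \<exists>B \<psi>. extends_spec A \<phi> B \<psi> \<and> zs \<subseteq> B"
proof -
  obtain T where T: "finite T" "\<And>A \<phi>. specialization A \<phi> \<Longrightarrow> t_rf \<in> A \<Longrightarrow> \<phi> t_rf \<notin> T \<Longrightarrow>
      \<exists>B \<psi>. extends_spec A \<phi> B \<psi> \<and> zs \<subseteq> B"
    using extension_over_t[OF assms] by blast
  obtain s where s: "s \<noteq> 0" "rf_eval2 s x t_rf = 0" by (rule t_algebraic_over)
  obtain p where p: "p \<noteq> 0" "rf_eval2 p t_rf x = 0" by (rule algebraic_over_t)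
  have "\<forall>c. \<exists>q. map_poly (\<lambda>d. poly d c) q \<noteq> 0 \<and> rf_eval2 q t_rf x = 0"
    using relation_nonzero_at[OF t_rf_nonconst p] by metis
  then obtain q where q: "\<And>c. map_poly (\<lambda>d. poly d c) (q c) \<noteq> 0" "\<And>c. rf_eval2 (q c) t_rf x = 0"
    by metis
  define E where "E = {a. poly (Polynomial.lead_coeff s) a = 0} \<union>
    (\<Union>c\<in>T. {a. poly (map_poly (\<lambda>d. poly d c) (q c)) a = 0})"
  have "finite E"
    using s(1) T(1) q(1) by (simp add: E_def poly_roots_finite)
  moreover have "\<exists>B \<psi>. extends_spec A \<phi> B \<psi> \<and> zs \<subseteq> B"
    if A: "specialization A \<phi>" "x \<in> A" "\<phi> x \<notin> E" for A \<phi>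
  proof -
    have "poly (Polynomial.lead_coeff s) (\<phi> x) \<noteq> 0" using A(3) by (simp add: E_def)
    then obtain C \<omega> where C: "extends_spec A \<phi> C \<omega>" "t_rf \<in> C"
      using extension_to_algebraic[OF A(1,2) s(2)] by blast
    then have C': "specialization C \<omega>" "x \<in> C" "\<omega> x = \<phi> x"
      using A(2) by (auto simp: extends_spec_def)
    interpret C: specialization C \<omega> by (rule C'(1))
    have "\<omega> t_rf \<notin> T"
    proof
      assume "\<omega> t_rf \<in> T"
      moreover have "poly (map_poly (\<lambda>d. poly d (\<omega> t_rf)) (q (\<omega> t_rf))) (\<phi> x) = 0"
        using C.hom_rf_eval2_poly[OF C(2) C'(2), of "q (\<omega> t_rf)"] q(2) C'(3) by simp
      ultimately show False using A(3) by (auto simp: E_def)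
    qed
    then obtain B \<psi> where "extends_spec C \<omega> B \<psi>" "zs \<subseteq> B"
      using T(2)[OF C'(1) C(2)] by blast
    then show ?thesis using extends_spec_trans[OF C(1)] by blast
  qed
  ultimately show ?thesis using that by blast
qed

text \<open>
  The evaluation at \<open>v\<close> of polynomial expressions in \<open>x\<close> and \<open>y\<close> is well defined on their values
  in the closure.
\<close>
lemma specialization_at_point:
  fixes v :: "'a::field ^ 2"
  assumes v: "\<And>g. rf_eval2 g x y = 0 \<Longrightarrow> eval2 g v = 0"
  obtains A \<phi> where "specialization A \<phi>" "x \<in> A" "y \<in> A" "\<phi> x = v $ 1" "\<phi> y = v $ 2"
proof -
  define \<phi> where "\<phi> z = (THE c. \<exists>g. z = rf_eval2 g x y \<and> c = eval2 g v)" for z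
  have add: "eval2 (g + h) v = eval2 g v + eval2 h v" for g h by (simp add: eval2_def)
  have \<phi>: "\<phi> (rf_eval2 g x y) = eval2 g v" for g
    unfolding \<phi>_def
  proof (rule the_equality)
    fix c assume "\<exists>h. rf_eval2 g x y = rf_eval2 h x y \<and> c = eval2 h v"
    then obtain h where h: "rf_eval2 g x y = rf_eval2 h x y" "c = eval2 h v" by blast
    have "eval2 (g - h) v = 0" by (rule v) (simp add: ev2.hom_diff h)
    then show "c = eval2 g v" using h(2) by (simp add: eval2_def)
  qed blast
  have const: "const_rf c = rf_eval2 [:[:c:]:] x y" for c by simp
  have "specialization (range (\<lambda>g. rf_eval2 g x y)) \<phi>"
  proof
    have "rf_eval2 1 x y = 1" by (rule ev2.hom_one)
    then show "1 \<in> range (\<lambda>g. rf_eval2 g x y)" by (metis rangeI)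
    show "\<phi> 1 = 1" using \<phi>[of 1] by (simp add: ev2.hom_one eval2_def)
    show "const_rf c \<in> range (\<lambda>g. rf_eval2 g x y)" for c unfolding const by (rule rangeI)
    show "\<phi> (const_rf c) = c" for c unfolding const \<phi> by (simp add: eval2_def)
  next
    fix z w assume "z \<in> range (\<lambda>g. rf_eval2 g x y)" "w \<in> range (\<lambda>g. rf_eval2 g x y)"
    then obtain g h where z: "z = rf_eval2 g x y" and w: "w = rf_eval2 h x y" by blast
    have s: "z + w = rf_eval2 (g + h) x y" and m: "z * w = rf_eval2 (g * h) x y"
      by (simp_all add: z w ev2.hom_add ev2.hom_mult)
    show "z + w \<in> range (\<lambda>g. rf_eval2 g x y)" "z * w \<in> range (\<lambda>g. rf_eval2 g x y)"
      unfolding s m by (rule rangeI)+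
    show "\<phi> (z + w) = \<phi> z + \<phi> w" "\<phi> (z * w) = \<phi> z * \<phi> w"
      unfolding s m unfolding z w \<phi> by (rule add eval2_mult)+
  next
    fix z assume "z \<in> range (\<lambda>g. rf_eval2 g x y)"
    then obtain g where "- z = rf_eval2 (- g) x y" by (auto simp: ev2.hom_uminus)
    then show "- z \<in> range (\<lambda>g. rf_eval2 g x y)" by blast
  qed
  moreover have xx: "x = rf_eval2 [:[:0, 1:]:] x y" and yy: "y = rf_eval2 [:0, 1:] x y"
    by simp_all
  moreover have "x \<in> range (\<lambda>g. rf_eval2 g x y)" "y \<in> range (\<lambda>g. rf_eval2 g x y)"
    using xx yy by (metis rangeI)+
  moreover have "\<phi> x = v $ 1" "\<phi> y = v $ 2"
    using \<phi>[of "[:[:0, 1:]:]"] \<phi>[of "[:0, 1:]"] by (simp_all add: eval2_def)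
  ultimately show ?thesis using that by blast
qed

text \<open>
  Any two elements of \<open>L\<close> are algebraically dependent, since \<open>L\<close> has transcendence degree one. The proof
  counts specializations: if \<open>x\<close> and \<open>y\<close> were independent, they could take any values \<open>a\<close> and \<open>b\<close>. For a
  suitable fixed \<open>a\<close> the specialization extends to \<open>t\<close>, whose value then is one of finitely many, and each of
  these admits only finitely many \<open>b\<close>.
\<close>
lemma algebraic_dependence:
  fixes x y :: "'a::{alg_closed_field, field_char_0} ratfun_closure"
  obtains g where "g \<noteq> 0" "rf_eval2 g x y = 0"
proof (rule ccontr)
  assume "\<not> thesis"
  with that have indep: "g = 0" if "rf_eval2 g x y = 0" for g using that by blast
  obtain E where E: "finite E" "\<And>A \<phi>. specialization A \<phi> \<Longrightarrow> x \<in> A \<Longrightarrow> \<phi> x \<notin> E \<Longrightarrow>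
      \<exists>B \<psi>. extends_spec A \<phi> B \<psi> \<and> {t_rf} \<subseteq> B"
    using extension_outside_finite[of "{t_rf}" x] by blast
  obtain s where s: "s \<noteq> 0" "rf_eval2 s x t_rf = 0" by (rule t_algebraic_over)
  have "finite (E \<union> {a. poly (Polynomial.lead_coeff s) a = 0})"
    using E(1) s(1) by (simp add: poly_roots_finite)
  then obtain a where a: "a \<notin> E" "poly (Polynomial.lead_coeff s) a \<noteq> 0"
    using ex_new_if_finite[OF infinite_UNIV_char_0] by blast
  define sa where "sa = map_poly (\<lambda>c. poly c a) s"
  have "Polynomial.coeff sa (Polynomial.degree s) \<noteq> 0" using a(2) by (simp add: sa_def coeff_map_poly)
  then have "sa \<noteq> 0" by auto
  define T where "T = {c. poly sa c = 0}"
  have "finite T" unfolding T_def by (rule poly_roots_finite) fact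
  obtain p where p: "p \<noteq> 0" "rf_eval2 p t_rf y = 0" by (rule algebraic_over_t)
  have "\<forall>c. \<exists>q. map_poly (\<lambda>d. poly d c) q \<noteq> 0 \<and> rf_eval2 q t_rf y = 0"
    using relation_nonzero_at[OF t_rf_nonconst p] by metis
  then obtain q where q: "\<And>c. map_poly (\<lambda>d. poly d c) (q c) \<noteq> 0" "\<And>c. rf_eval2 (q c) t_rf y = 0"
    by metis
  have "finite (\<Union>c\<in>T. {b. poly (map_poly (\<lambda>d. poly d c) (q c)) b = 0})"
    using \<open>finite T\<close> q(1) by (simp add: poly_roots_finite)
  then obtain b where b: "b \<notin> (\<Union>c\<in>T. {b. poly (map_poly (\<lambda>d. poly d c) (q c)) b = 0})"
    using ex_new_if_finite[OF infinite_UNIV_char_0] by blast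
  define v :: "'a ^ 2" where "v = vector [a, b]"
  have v12: "v $ 1 = a" "v $ 2 = b" by (simp_all add: v_def)
  have "eval2 g v = 0" if "rf_eval2 g x y = 0" for g
    using indep[OF that] by simp
  then obtain A \<phi> where "specialization A \<phi>" "x \<in> A" "y \<in> A" "\<phi> x = v $ 1" "\<phi> y = v $ 2"
    using specialization_at_point[of x y v] by blast
  then have A: "specialization A \<phi>" "x \<in> A" "y \<in> A" "\<phi> x = a" "\<phi> y = b"
    by (simp_all only: v12)
  then obtain B \<psi> where B: "extends_spec A \<phi> B \<psi>" "t_rf \<in> B"
    using E(2)[OF A(1,2)] a(1) by auto
  then have B': "specialization B \<psi>" "x \<in> B" "y \<in> B" "\<psi> x = a" "\<psi> y = b"
    using A by (auto simp: extends_spec_def)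
  interpret B: specialization B \<psi> by (rule B'(1))
  have "\<psi> t_rf \<in> T"
    using B.hom_rf_eval2_poly[OF B'(2) B(2), of s] s(2) B'(4) by (simp add: T_def sa_def)
  moreover have "poly (map_poly (\<lambda>d. poly d (\<psi> t_rf)) (q (\<psi> t_rf))) b = 0"
    using B.hom_rf_eval2_poly[OF B(2) B'(3), of "q (\<psi> t_rf)"] q(2) B'(5) by simp
  ultimately show False using b by blast
qed

text \<open>
  The pair \<open>(a, b)\<close> lies on the locus of \<open>(x, y)\<close> and lifts to values of the elements of \<open>zs\<close>. For empty
  \<open>zs\<close> this is the locus itself.
\<close>
definition specializes_over ::
  "'a::field ratfun_closure set \<Rightarrow> 'a ratfun_closure \<Rightarrow> 'a ratfun_closure \<Rightarrow> 'a \<Rightarrow> 'a \<Rightarrow> bool" where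
  "specializes_over zs x y a b \<longleftrightarrow>
     (\<exists>A \<phi>. specialization A \<phi> \<and> x \<in> A \<and> y \<in> A \<and> zs \<subseteq> A \<and> \<phi> x = a \<and> \<phi> y = b)"

lemma specializes_over_commute: "specializes_over zs x y a b \<longleftrightarrow> specializes_over zs y x b a"
  unfolding specializes_over_def by blast

text \<open>
  Only finitely many \<open>a\<close> can fail to lift, and a relation between \<open>x\<close> and \<open>y\<close> that stays nontrivial at \<open>a\<close>
  leaves finitely many \<open>b\<close> for each of them.
\<close>
lemma finite_nonlifting_pairs:
  fixes x y :: "'a::{alg_closed_field, field_char_0} ratfun_closure"
  assumes x: "x \<notin> range const_rf" and zs: "finite zs"
  shows "finite {(a, b). specializes_over {} x y a b \<and> \<not> specializes_over zs x y a b}"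
proof -
  obtain E where E: "finite E" "\<And>A \<phi>. specialization A \<phi> \<Longrightarrow> x \<in> A \<Longrightarrow> \<phi> x \<notin> E \<Longrightarrow>
      \<exists>B \<psi>. extends_spec A \<phi> B \<psi> \<and> zs \<subseteq> B"
    using extension_outside_finite[OF zs] by blast
  have "finite {b. specializes_over {} x y a b}" for a
  proof -
    obtain g where "g \<noteq> 0" "rf_eval2 g x y = 0" by (rule algebraic_dependence)
    then obtain h where h: "map_poly (\<lambda>c. poly c a) h \<noteq> 0" "rf_eval2 h x y = 0"
      using relation_nonzero_at[OF x] by blast
    have "{b. specializes_over {} x y a b} \<subseteq> {b. poly (map_poly (\<lambda>c. poly c a) h) b = 0}"
    proof
      fix b assume "b \<in> {b. specializes_over {} x y a b}"
      then obtain A \<phi> where A: "specialization A \<phi>" "x \<in> A" "y \<in> A" "\<phi> x = a" "\<phi> y = b"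
        by (auto simp: specializes_over_def)
      interpret specialization A \<phi> by (rule A(1))
      show "b \<in> {b. poly (map_poly (\<lambda>c. poly c a) h) b = 0}"
        using hom_rf_eval2_poly[OF A(2,3), of h] A(4,5) h(2) by simp
    qed
    then show ?thesis by (rule finite_subset) (rule poly_roots_finite[OF h(1)])
  qed
  then have "finite (Sigma E (\<lambda>a. {b. specializes_over {} x y a b}))" using E(1) by blast
  moreover have "{(a, b). specializes_over {} x y a b \<and> \<not> specializes_over zs x y a b} \<subseteq>
      Sigma E (\<lambda>a. {b. specializes_over {} x y a b})"
  proof clarify
    fix a b assume ab: "specializes_over {} x y a b" "\<not> specializes_over zs x y a b"
    then obtain A \<phi> where A: "specialization A \<phi>" "x \<in> A" "y \<in> A" "\<phi> x = a" "\<phi> y = b"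
      by (auto simp: specializes_over_def)
    have "a \<in> E"
    proof (rule ccontr)
      assume "a \<notin> E"
      then obtain B \<psi> where B: "extends_spec A \<phi> B \<psi>" "zs \<subseteq> B"
        using E(2)[OF A(1,2)] A(4) by blast
      then have "specializes_over zs x y a b"
        unfolding specializes_over_def extends_spec_def using A by (metis subsetD)
      with ab(2) show False by simp
    qed
    then show "a \<in> E \<and> b \<in> {b. specializes_over {} x y a b}" using ab(1) by simp
  qed
  ultimately show ?thesis by (rule rev_finite_subset)
qed

lemma finite_nonlifting:
  fixes x y :: "'a::{alg_closed_field, field_char_0} ratfun_closure"
  assumes xy: "x \<notin> range const_rf \<or> y \<notin> range const_rf" and zs: "finite zs"
  shows "finite {(a, b). specializes_over {} x y a b \<and> \<not> specializes_over zs x y a b}"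
proof (cases "x \<in> range const_rf")
  case False
  then show ?thesis by (rule finite_nonlifting_pairs[OF _ zs])
next
  case True
  with xy have y: "y \<notin> range const_rf" by simp
  have "{(a, b). specializes_over {} x y a b \<and> \<not> specializes_over zs x y a b} =
    prod.swap ` {(b, a). specializes_over {} y x b a \<and> \<not> specializes_over zs y x b a}"
    by (auto simp: specializes_over_commute[of _ y x])
  then show ?thesis using finite_nonlifting_pairs[OF y zs] by simp
qed

section \<open>Adjoining a radical to the last field of a tower\<close>

text \<open>
  The subfields of \<open>L\<close> that contain \<open>F(t)\<close>. Negatives need no clause, as \<open>- 1\<close> is in the range of
  \<open>to_ac\<close>.
\<close>
definition const_subfield :: "'a::field ratfun_closure set \<Rightarrow> bool" where
  "const_subfield K \<longleftrightarrow> range to_ac \<subseteq> K \<and>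
     (\<forall>x\<in>K. \<forall>y\<in>K. x + y \<in> K \<and> x * y \<in> K) \<and> (\<forall>x\<in>K. inverse x \<in> K)"

lemma const_subfield_range_to_ac: "const_subfield (range to_ac)"
  unfolding const_subfield_def
  by (auto simp flip: to_ac_add to_ac_mult to_ac_inverse)

lemma const_subfield_splitting_field:
  assumes "const_subfield K"
  shows "const_subfield (splitting_field K p)" and "K \<subseteq> splitting_field K p"
    and "poly p x = 0 \<Longrightarrow> x \<in> splitting_field K p"
proof -
  let ?R = "ring_of_type_algebra :: 'a ratfun_closure ring"
  let ?H = "K \<union> {x. poly p x = 0}"
  have sf: "splitting_field K p = generate_field ?R ?H" by (simp add: splitting_field_def)
  interpret R: field ?R by (rule field_from_type_algebra)
  show K: "K \<subseteq> splitting_field K p" and "poly p x = 0 \<Longrightarrow> x \<in> splitting_field K p"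
    unfolding sf by (auto intro: generate_field.incl)
  have ops: "x \<oplus>\<^bsub>?R\<^esub> y = x + y" "x \<otimes>\<^bsub>?R\<^esub> y = x * y" "\<zero>\<^bsub>?R\<^esub> = 0" "\<one>\<^bsub>?R\<^esub> = 1"
    "carrier ?R = UNIV" for x y
    by (simp_all add: ring_of_type_algebra_def)
  have inv: "inv\<^bsub>?R\<^esub> x = inverse x" if "x \<noteq> 0" for x
    by (rule R.comm_inv_char) (use that in \<open>simp_all add: ops\<close>)
  have to_ac: "range to_ac \<subseteq> splitting_field K p"
    using assms K by (auto simp: const_subfield_def)
  have "x + y \<in> splitting_field K p" "x * y \<in> splitting_field K p"
    if "x \<in> splitting_field K p" "y \<in> splitting_field K p" for x y
    using that generate_field.eng_add[of x ?R ?H y] generate_field.eng_mult[of x ?R ?H y]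
    unfolding sf ops by blast+
  moreover have "inverse x \<in> splitting_field K p" if "x \<in> splitting_field K p" for x
  proof (cases "x = 0")
    case True
    then show ?thesis using that by simp
  next
    case False
    then show ?thesis
      using that generate_field.m_inv[of x ?R ?H] inv[OF False] unfolding sf ops by simp
  qed
  ultimately show "const_subfield (splitting_field K p)"
    using to_ac unfolding const_subfield_def by blast
qed

lemma root_tower_const_subfield:
  assumes tower: "root_tower g Ks" and "i < length Ks"
  shows "const_subfield (Ks ! i)"
  using assms(2)
proof (induction i)
  case 0
  then have "Ks ! 0 = range to_ac"
    using tower by (simp add: root_tower_def hd_conv_nth)
  then show ?case by (simp add: const_subfield_range_to_ac)
next
  case (Suc i)
  then obtain l a where "Ks ! Suc i = splitting_field (Ks ! i) (monom 1 l - [:a:])"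
    using tower unfolding root_tower_def by blast
  with Suc show ?case by (simp add: const_subfield_splitting_field(1))
qed

lemma root_tower_last:
  assumes "root_tower g Ks"
  shows "const_subfield (last Ks)"
proof -
  have "Ks \<noteq> []" using assms by (simp add: root_tower_def)
  then show ?thesis
    using root_tower_const_subfield[OF assms, of "length Ks - 1"] by (simp add: last_conv_nth)
qed

lemma root_tower_snoc:
  assumes tower: "root_tower g Ks" and a: "a \<in> last Ks" "a \<noteq> 0" and l: "0 < l"
  shows "root_tower g (Ks @ [splitting_field (last Ks) (monom 1 l - [:a:])])"
proof -
  let ?E = "splitting_field (last Ks) (monom 1 l - [:a:])"
  have Ks: "Ks \<noteq> []" using tower by (simp add: root_tower_def)
  have "\<exists>l>0. \<exists>a\<in>(Ks @ [?E]) ! i. a \<noteq> 0 \<and>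
      (Ks @ [?E]) ! Suc i = splitting_field ((Ks @ [?E]) ! i) (monom 1 l - [:a:])"
    if i: "Suc i < length (Ks @ [?E])" for i
  proof (cases "Suc i < length Ks")
    case True
    then show ?thesis using tower by (auto simp: root_tower_def nth_append)
  next
    case False
    with i have "Suc i = length Ks" by simp
    then have "(Ks @ [?E]) ! i = last Ks" "(Ks @ [?E]) ! Suc i = ?E"
      using Ks by (auto simp: nth_append last_conv_nth simp flip: \<open>Suc i = length Ks\<close>)
    then show ?thesis using a l by auto
  qed
  moreover have "last Ks \<subseteq> ?E"
    by (rule const_subfield_splitting_field(2)[OF root_tower_last[OF tower]])
  ultimately show ?thesis
    using tower Ks by (auto simp: root_tower_def)
qed

lemma const_subfield_subring:
  assumes "const_subfield K"
  shows "subring_hom K (\<lambda>x. x)" and "const_rf c \<in> K"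
proof -
  have m1: "- x = to_ac (- 1) * x" for x :: "'a ratfun_closure" by simp
  have "to_ac (- 1) \<in> K" "to_ac 1 \<in> K" using assms unfolding const_subfield_def by blast+
  then show "subring_hom K (\<lambda>x. x)"
    using assms by unfold_locales (auto simp: const_subfield_def m1 simp del: to_ac_minus)
  show "const_rf c \<in> K" using assms by (auto simp: const_subfield_def const_rf_def)
qed

lemma const_subfield_rf_eval2:
  assumes K: "const_subfield K" and xy: "x \<in> K" "y \<in> K"
  shows "rf_eval2 h x y \<in> K"
proof -
  interpret subring_hom K "\<lambda>x. x" by (rule const_subfield_subring(1)[OF K])
  have "rf_eval1 p x \<in> K" for p
    unfolding rf_eval1_def
    by (rule poly_mem[OF _ xy(1)]) (simp add: coeff_map_poly const_subfield_subring(2)[OF K])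
  then show ?thesis
    unfolding rf_eval2_def by (intro poly_mem[OF _ xy(2)]) (simp add: coeff_map_poly)
qed

section \<open>Zariski closed sets\<close>

abbreviation zariski_closed :: "('a::comm_ring_1 ^ 2) set \<Rightarrow> bool" where
  "zariski_closed U \<equiv> zariski_closure U \<subseteq> U"

lemma zariski_closure_subset:
  "S \<subseteq> U \<Longrightarrow> zariski_closed U \<Longrightarrow> zariski_closure S \<subseteq> U"
  unfolding zariski_closure_def by blast

lemma zariski_closed_Un:
  fixes U U' :: "('a::idom ^ 2) set"
  assumes "zariski_closed U" "zariski_closed U'"
  shows "zariski_closed (U \<union> U')"
proof
  fix u assume u: "u \<in> zariski_closure (U \<union> U')"
  show "u \<in> U \<union> U'"
  proof (rule ccontr)
    assume "u \<notin> U \<union> U'"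
    then have "u \<notin> zariski_closure U" "u \<notin> zariski_closure U'" using assms by auto
    then obtain g h where "\<forall>v\<in>U. eval2 g v = 0" "eval2 g u \<noteq> 0"
      "\<forall>v\<in>U'. eval2 h v = 0" "eval2 h u \<noteq> 0"
      unfolding zariski_closure_def by blast
    then have "\<forall>v\<in>U \<union> U'. eval2 (g * h) v = 0" "eval2 (g * h) u \<noteq> 0"
      by (auto simp: eval2_mult)
    with u show False unfolding zariski_closure_def by blast
  qed
qed

lemma zariski_closure_empty: "zariski_closure ({} :: ('a::comm_ring_1 ^ 2) set) = {}"
proof -
  have "eval2 1 u \<noteq> 0" for u :: "'a ^ 2" by (simp add: eval2_def)
  then show ?thesis unfolding zariski_closure_def by blast
qed

lemma zariski_closed_UN:
  fixes Z :: "'i \<Rightarrow> ('a::idom ^ 2) set"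
  assumes "finite I" "\<And>i. i \<in> I \<Longrightarrow> zariski_closed (Z i)"
  shows "zariski_closed (\<Union>i\<in>I. Z i)"
  using assms
  by (induction I rule: finite_induct) (simp_all add: zariski_closure_empty zariski_closed_Un)

lemma zariski_closed_singleton: "zariski_closed {p :: 'a::idom ^ 2}"
proof
  fix u assume u: "u \<in> zariski_closure {p}"
  then have *: "eval2 g u = 0" if "eval2 g p = 0" for g
    using that by (simp add: zariski_closure_def)
  have "u $ 1 = p $ 1" "u $ 2 = p $ 2"
    using *[of "[:[:- (p $ 1), 1:]:]"] *[of "[:[:- (p $ 2):], 1:]"] by (simp_all add: eval2_def)
  then show "u \<in> {p}" by (simp add: vec_eq_iff forall_2)
qed

lemma zariski_closed_finite:
  assumes "finite (U :: ('a::idom ^ 2) set)" shows "zariski_closed U"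
  using zariski_closed_UN[OF assms, of "\<lambda>p. {p}", OF zariski_closed_singleton] by simp

text \<open>
  The locus of the generic point \<open>Q\<close>.
\<close>
definition specializations_of :: "('a::field ratfun_closure) ^ 2 \<Rightarrow> ('a ^ 2) set" where
  "specializations_of Q = {u. \<forall>g. rf_eval2 g (Q $ 1) (Q $ 2) = 0 \<longrightarrow> eval2 g u = 0}"

lemma zariski_closed_specializations: "zariski_closed (specializations_of Q)"
  unfolding zariski_closure_def specializations_of_def by blast

lemma specializations_of_imp_specializes:
  fixes Q :: "('a::field ratfun_closure) ^ 2" and u :: "'a ^ 2"
  assumes "u \<in> specializations_of Q"
  shows "specializes_over {} (Q $ 1) (Q $ 2) (u $ 1) (u $ 2)"
proof -
  have "eval2 g u = 0" if "rf_eval2 g (Q $ 1) (Q $ 2) = 0" for g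
    using assms that unfolding specializations_of_def by blast
  then show ?thesis
    using specialization_at_point[of "Q $ 1" "Q $ 2" u] unfolding specializes_over_def by blast
qed

lemma value_specializes:
  fixes Q :: "('a::alg_closed_field ratfun_closure) ^ 2"
  assumes place: "place_at t0 V" and def: "defined_at V Q"
  shows "residue V (rf_eval2 g (Q $ 1) (Q $ 2)) = eval2 g (value_at V Q)"
proof -
  interpret specialization V "residue V" by (rule place_specialization[OF place])
  show ?thesis
    using def by (intro hom_rf_eval2) (simp_all add: defined_at_def value_at_def)
qed

lemma value_in_specializations:
  fixes Q :: "('a::alg_closed_field ratfun_closure) ^ 2"
  assumes place: "place_at t0 V" and def: "defined_at V Q"
  shows "value_at V Q \<in> specializations_of Q"
proof -
  interpret specialization V "residue V" by (rule place_specialization[OF place])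
  have "eval2 g (value_at V Q) = 0" if "rf_eval2 g (Q $ 1) (Q $ 2) = 0" for g
    using value_specializes[OF place def, of g] that by simp
  then show ?thesis unfolding specializations_of_def by blast
qed

section \<open>The offset of a generic point\<close>

text \<open>
  The set whose closure is the offset. A single coefficient \<open>w\<close> with \<open>w^2 |\<nabla>f(P)|^2 = d^2\<close> replaces the two
  signs and the arbitrary choice of the square root in \<open>norm2\<close>.
\<close>
definition offset_points :: "'a::idom poly poly \<Rightarrow> 'a \<Rightarrow> ('a ^ 2) set" where
  "offset_points f d = {P + w *s grad2 f P |P w.
     eval2 f P = 0 \<and> w\<^sup>2 * ((grad2 f P $ 1)\<^sup>2 + (grad2 f P $ 2)\<^sup>2) = d\<^sup>2}"

lemma offset_conv_offset_points:
  assumes d: "d \<noteq> 0"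
  shows "offset f d = zariski_closure (offset_points f d)"
proof -
  have n2: "(norm2 v)\<^sup>2 = (v $ 1)\<^sup>2 + (v $ 2)\<^sup>2" for v :: "'a ^ 2"
    unfolding norm2_def by (rule someI_ex) (rule nth_root_exists, simp)
  have minus: "P - c *s v = P + (- c) *s v" for P v :: "'a ^ 2" and c
    by (simp add: vec_eq_iff)
  have "{P + (d / norm2 (grad2 f P)) *s grad2 f P |P. P \<in> plane_curve f \<and> norm2 (grad2 f P) \<noteq> 0} \<union>
      {P - (d / norm2 (grad2 f P)) *s grad2 f P |P. P \<in> plane_curve f \<and> norm2 (grad2 f P) \<noteq> 0}
      = offset_points f d" (is "?S = _")
  proof (intro equalityI subsetI)
    fix u assume "u \<in> ?S"
    then obtain P w where P: "P \<in> plane_curve f" "norm2 (grad2 f P) \<noteq> 0"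
      and u: "u = P + w *s grad2 f P"
      and w: "w = d / norm2 (grad2 f P) \<or> w = - (d / norm2 (grad2 f P))"
      unfolding minus by blast
    have "w\<^sup>2 * (norm2 (grad2 f P))\<^sup>2 = d\<^sup>2"
      using w P(2) by (auto simp: power_divide)
    with u P(1) show "u \<in> offset_points f d"
      unfolding offset_points_def plane_curve_def n2 by blast
  next
    fix u assume "u \<in> offset_points f d"
    then obtain P w where P: "eval2 f P = 0" and u: "u = P + w *s grad2 f P"
      and "w\<^sup>2 * (norm2 (grad2 f P))\<^sup>2 = d\<^sup>2"
      unfolding offset_points_def n2 by blast
    then have w: "w * norm2 (grad2 f P) = d \<or> w * norm2 (grad2 f P) = - d"
      by (simp add: power2_eq_iff flip: power_mult_distrib)
    then have n: "norm2 (grad2 f P) \<noteq> 0" using d by auto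
    then have "w = d / norm2 (grad2 f P) \<or> w = - (d / norm2 (grad2 f P))"
      using w by (metis nonzero_eq_divide_eq minus_divide_left)
    then show "u \<in> ?S"
      unfolding minus using P n u by (auto simp: plane_curve_def)
  qed
  then show ?thesis unfolding offset_def by simp
qed

definition rf_grad_sq ::
  "'a::field poly poly \<Rightarrow> ('a ratfun_closure) ^ 2 \<Rightarrow> 'a ratfun_closure" where
  "rf_grad_sq f R = (rf_eval2 (map_poly pderiv f) (R $ 1) (R $ 2))\<^sup>2 +
     (rf_eval2 (pderiv f) (R $ 1) (R $ 2))\<^sup>2"

text \<open>
  With \<open>w^2\<close> times \<open>rf_grad_sq f R\<close> equal to \<open>d^2\<close>, this is one of the two points of the normal
  at the generic point \<open>R\<close> that have distance \<open>d\<close> from it.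
\<close>
definition rf_offset ::
  "'a::field poly poly \<Rightarrow> ('a ratfun_closure) ^ 2 \<Rightarrow> 'a ratfun_closure \<Rightarrow> ('a ratfun_closure) ^ 2" where
  "rf_offset f R w = vector [R $ 1 + w * rf_eval2 (map_poly pderiv f) (R $ 1) (R $ 2),
     R $ 2 + w * rf_eval2 (pderiv f) (R $ 1) (R $ 2)]"

lemma specialize_rf_offset:
  fixes R :: "('a::field ratfun_closure) ^ 2" and P :: "'a ^ 2"
  assumes spec: "specialization A \<phi>" and A: "R $ 1 \<in> A" "R $ 2 \<in> A" "w \<in> A"
    and P: "P $ 1 = \<phi> (R $ 1)" "P $ 2 = \<phi> (R $ 2)"
  shows "rf_offset f R w $ i \<in> A"
    and "\<phi> (rf_offset f R w $ i) = (P + \<phi> w *s grad2 f P) $ i"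
    and "rf_grad_sq f R \<in> A"
    and "\<phi> (rf_grad_sq f R) = (grad2 f P $ 1)\<^sup>2 + (grad2 f P $ 2)\<^sup>2"
proof -
  interpret specialization A \<phi> by (rule spec)
  note mem = rf_eval2_mem[OF A(1,2)] and hom = hom_rf_eval2[OF A(1,2) P]
  have "\<forall>i. rf_offset f R w $ i \<in> A \<and> \<phi> (rf_offset f R w $ i) = (P + \<phi> w *s grad2 f P) $ i"
    unfolding forall_2 rf_offset_def
    using A P by (simp add: grad2_def mem hom add_mem mult_mem hom_add hom_mult)
  then show "rf_offset f R w $ i \<in> A" "\<phi> (rf_offset f R w $ i) = (P + \<phi> w *s grad2 f P) $ i"
    by blast+
  show "rf_grad_sq f R \<in> A"
    unfolding rf_grad_sq_def by (intro add_mem power_mem mem)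
  show "\<phi> (rf_grad_sq f R) = (grad2 f P $ 1)\<^sup>2 + (grad2 f P $ 2)\<^sup>2"
    unfolding rf_grad_sq_def by (simp add: grad2_def mem hom power_mem hom_add hom_power)
qed

text \<open>
  The equations that define \<open>offset_points\<close> are polynomial in the coordinates of \<open>R\<close> and in \<open>w\<close>, so a
  specialization preserves them.
\<close>
lemma specialize_in_offset_points:
  fixes R :: "('a::field ratfun_closure) ^ 2" and u :: "'a ^ 2"
  assumes spec: "specialization A \<phi>" and A: "R $ 1 \<in> A" "R $ 2 \<in> A" "w \<in> A"
    and R: "rf_eval2 f (R $ 1) (R $ 2) = 0" and w: "w\<^sup>2 * rf_grad_sq f R = const_rf (d\<^sup>2)"
    and u: "\<And>i. u $ i = \<phi> (rf_offset f R w $ i)"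
  shows "u \<in> offset_points f d"
proof -
  interpret specialization A \<phi> by (rule spec)
  define P :: "'a ^ 2" where "P = vector [\<phi> (R $ 1), \<phi> (R $ 2)]"
  have P: "P $ 1 = \<phi> (R $ 1)" "P $ 2 = \<phi> (R $ 2)" by (simp_all add: P_def)
  note so = specialize_rf_offset[OF spec A P]
  have "eval2 f P = 0" using hom_rf_eval2[OF A(1,2) P, of f] R by simp
  moreover have "(\<phi> w)\<^sup>2 * ((grad2 f P $ 1)\<^sup>2 + (grad2 f P $ 2)\<^sup>2) = d\<^sup>2"
    using arg_cong[OF w, of \<phi>] so(3,4)[of f] A(3)
    by (simp add: hom_mult hom_power power_mem)
  moreover have "u = P + \<phi> w *s grad2 f P"
    unfolding vec_eq_iff u so(2) by blast
  ultimately show ?thesis unfolding offset_points_def by blast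
qed

lemma finite_square_roots:
  fixes N c :: "'b::idom"
  assumes "c \<noteq> 0"
  shows "finite {w. w\<^sup>2 * N = c}"
proof -
  have "finite {w. poly [:- c, 0, N:] w = 0}"
    by (rule poly_roots_finite) (use assms in simp)
  moreover have "{w. w\<^sup>2 * N = c} \<subseteq> {w. poly [:- c, 0, N:] w = 0}"
    by (auto simp: power2_eq_square algebra_simps)
  ultimately show ?thesis by (rule rev_finite_subset)
qed

text \<open>
  The tower of \<open>R\<close> is prolonged by the splitting field of \<open>x^2 - d^2 / N\<close>, which contains \<open>w\<close>.
\<close>
lemma square_parametrization_rf_offset:
  fixes R :: "('a::field ratfun_closure) ^ 2"
  assumes R: "square_parametrization R" and d: "d \<noteq> 0"
    and w: "w\<^sup>2 * rf_grad_sq f R = const_rf (d\<^sup>2)"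
    and nonconst: "\<not> (\<forall>i. rf_offset f R w $ i \<in> range const_rf)"
  shows "square_parametrization (rf_offset f R w)"
proof -
  obtain g Ks where g: "soluble_by_radicals g" "root_tower g Ks" "\<And>i. R $ i \<in> last Ks"
    using R unfolding square_parametrization_def by blast
  let ?K = "last Ks" and ?N = "rf_grad_sq f R"
  have K: "const_subfield ?K" by (rule root_tower_last[OF g(2)])
  interpret K: subring_hom ?K "\<lambda>x. x" by (rule const_subfield_subring(1)[OF K])
  have N: "?N \<in> ?K"
    unfolding rf_grad_sq_def by (intro K.add_mem K.power_mem const_subfield_rf_eval2[OF K] g(3))
  have N0: "?N \<noteq> 0" using w d by auto
  define a where "a = const_rf (d\<^sup>2) * inverse ?N"
  have "inverse ?N \<in> ?K" using K N unfolding const_subfield_def by blast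
  then have a: "a \<in> ?K" unfolding a_def by (intro K.mult_mem const_subfield_subring(2)[OF K])
  have a0: "a \<noteq> 0" using d N0 by (simp add: a_def)
  have wa: "w\<^sup>2 = a" using w N0 by (simp add: a_def field_simps)
  let ?E = "splitting_field ?K (monom 1 2 - [:a:])"
  have tower: "root_tower g (Ks @ [?E])"
    by (rule root_tower_snoc[OF g(2) a a0]) simp
  note E = const_subfield_splitting_field[OF K, of "monom 1 2 - [:a:]"]
  have wE: "w \<in> ?E" by (rule E(3)) (simp add: poly_monom wa)
  have RE: "R $ i \<in> ?E" for i using g(3) E(2) by blast
  interpret E: subring_hom ?E "\<lambda>x. x" by (rule const_subfield_subring(1)[OF E(1)])
  have "\<forall>i. rf_offset f R w $ i \<in> ?E"
    unfolding forall_2 rf_offset_def vector_2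
    by (intro conjI E.add_mem E.mult_mem wE RE const_subfield_rf_eval2[OF E(1)])
  then have "\<forall>i. rf_offset f R w $ i \<in> last (Ks @ [?E])" by simp
  then show ?thesis
    unfolding square_parametrization_def using g(1) tower nonconst by blast
qed

text \<open>
  Only finitely many \<open>t0\<close> leave \<open>R\<close> undefined, so the residues of \<open>h(R)\<close> vanish at almost all \<open>t0\<close>.
\<close>
lemma generic_point_on_zero_set:
  fixes R :: "('a::{alg_closed_field, field_char_0} ratfun_closure) ^ 2"
  assumes places: "\<And>t0. place_at t0 (pl t0)"
    and fin: "finite {t0. defined_at (pl t0) R \<and> eval2 h (value_at (pl t0) R) \<noteq> 0}"
  shows "rf_eval2 h (R $ 1) (R $ 2) = 0"
proof (rule zero_if_residues_vanish[of pl, OF places _ infinite_UNIV_char_0])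
  let ?S = "rf_eval2 h (R $ 1) (R $ 2)"
  have "{t0. \<not> (?S \<in> pl t0 \<and> residue (pl t0) ?S = 0)} \<subseteq>
      {t0. R $ 1 \<notin> pl t0} \<union> {t0. R $ 2 \<notin> pl t0} \<union>
      {t0. defined_at (pl t0) R \<and> eval2 h (value_at (pl t0) R) \<noteq> 0}"
  proof
    fix t0 assume t0: "t0 \<in> {t0. \<not> (?S \<in> pl t0 \<and> residue (pl t0) ?S = 0)}"
    interpret specialization "pl t0" "residue (pl t0)" by (rule place_specialization[OF places])
    have "eval2 h (value_at (pl t0) R) \<noteq> 0" if def: "defined_at (pl t0) R"
    proof -
      have "?S \<in> pl t0" using def by (intro rf_eval2_mem) (simp_all add: defined_at_def)
      then show ?thesis using t0 value_specializes[OF places def, of h] by simp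
    qed
    then show "t0 \<in> {t0. R $ 1 \<notin> pl t0} \<union> {t0. R $ 2 \<notin> pl t0} \<union>
      {t0. defined_at (pl t0) R \<and> eval2 h (value_at (pl t0) R) \<noteq> 0}"
      by (auto simp: defined_at_def forall_2)
  qed
  then show "finite {t0. \<not> (?S \<in> pl t0 \<and> residue (pl t0) ?S = 0)}"
    by (rule finite_subset)
      (simp add: fin finite_undefined[of pl, OF places])
qed

text \<open>
  At a place where \<open>Q\<close> is defined but \<open>R\<close> or \<open>w\<close> is not, the value of \<open>Q\<close> need not be an offset
  point. It is still a limit of such points: polynomials that vanish on them vanish at the generic point \<open>Q\<close>.
\<close>
lemma value_rf_offset_in_closure:
  fixes R :: "('a::{alg_closed_field, field_char_0} ratfun_closure) ^ 2"
  assumes places: "\<And>t0. place_at t0 (pl t0)"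
    and R: "rf_eval2 f (R $ 1) (R $ 2) = 0" and w: "w\<^sup>2 * rf_grad_sq f R = const_rf (d\<^sup>2)"
    and def: "defined_at (pl t1) (rf_offset f R w)"
  shows "value_at (pl t1) (rf_offset f R w) \<in> zariski_closure (offset_points f d)"
proof -
  let ?Q = "rf_offset f R w"
  have "eval2 g (value_at (pl t1) ?Q) = 0" if g: "\<forall>P\<in>offset_points f d. eval2 g P = 0" for g
  proof -
    have "{t0. defined_at (pl t0) ?Q \<and> eval2 g (value_at (pl t0) ?Q) \<noteq> 0} \<subseteq>
        {t0. R $ 1 \<notin> pl t0} \<union> {t0. R $ 2 \<notin> pl t0} \<union> {t0. w \<notin> pl t0}"
    proof
      fix t0 assume t0: "t0 \<in> {t0. defined_at (pl t0) ?Q \<and> eval2 g (value_at (pl t0) ?Q) \<noteq> 0}"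
      have "value_at (pl t0) ?Q \<in> offset_points f d"
        if "R $ 1 \<in> pl t0" "R $ 2 \<in> pl t0" "w \<in> pl t0"
        by (rule specialize_in_offset_points[OF place_specialization[OF places] that R w])
          (simp add: value_at_def)
      with t0 g show "t0 \<in> {t0. R $ 1 \<notin> pl t0} \<union> {t0. R $ 2 \<notin> pl t0} \<union> {t0. w \<notin> pl t0}"
        by blast
    qed
    then have "finite {t0. defined_at (pl t0) ?Q \<and> eval2 g (value_at (pl t0) ?Q) \<noteq> 0}"
      by (rule finite_subset) (simp add: finite_undefined[of pl, OF places])
    from generic_point_on_zero_set[of pl, OF places this]
    have "rf_eval2 g (?Q $ 1) (?Q $ 2) = 0" .
    then show ?thesis
      using value_in_specializations[OF places def] unfolding specializations_of_def by blast
  qed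
  then show ?thesis unfolding zariski_closure_def by blast
qed

text \<open>
  The value of \<open>N\<close> at the place is not zero, so \<open>N\<close> is a unit of the valuation ring, and the square roots of
  \<open>d^2 / N\<close> are integral. Their values are \<open>\<omega>\<close> and \<open>- \<omega>\<close>, in an order that depends on the place.
\<close>
lemma offset_points_over_value:
  fixes R :: "('a::alg_closed_field ratfun_closure) ^ 2"
  assumes place: "place_at t0 V" and def: "defined_at V R" and P: "P = value_at V R"
    and d: "d \<noteq> 0"
    and \<omega>: "\<omega>\<^sup>2 * ((grad2 f P $ 1)\<^sup>2 + (grad2 f P $ 2)\<^sup>2) = d\<^sup>2"
  obtains w where "w\<^sup>2 * rf_grad_sq f R = const_rf (d\<^sup>2)"
    "defined_at V (rf_offset f R w)" "value_at V (rf_offset f R w) = P + \<omega> *s grad2 f P"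
proof -
  interpret specialization V "residue V" by (rule place_specialization[OF place])
  let ?N = "rf_grad_sq f R"
  have R: "R $ 1 \<in> V" "R $ 2 \<in> V" using def by (simp_all add: defined_at_def)
  have P12: "P $ 1 = residue V (R $ 1)" "P $ 2 = residue V (R $ 2)"
    by (simp_all add: P value_at_def)
  note so = specialize_rf_offset[OF place_specialization[OF place] R _ P12]
  have N: "?N \<in> V" and rN: "\<omega>\<^sup>2 * residue V ?N = d\<^sup>2"
    using so(3,4)[OF zero_mem] \<omega> by simp_all
  have rN0: "residue V ?N \<noteq> 0" using rN d by auto
  then have N0: "?N \<noteq> 0" by auto
  have Ninv: "inverse ?N \<in> V"
  proof (rule ccontr)
    assume "inverse ?N \<notin> V"
    with N have "?N - const_rf 0 \<in> val_max_ideal V" by (simp add: val_max_ideal_def)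
    from residue_eqI[OF place this] rN0 show False by simp
  qed
  obtain w where w: "w\<^sup>2 = const_rf (d\<^sup>2) * inverse ?N"
    using nth_root_exists[of 2] by (metis zero_less_numeral)
  have w2V: "w\<^sup>2 \<in> V" unfolding w by (intro mult_mem const_mem Ninv)
  have wV: "w \<in> V"
  proof (rule ccontr)
    assume nw: "w \<notin> V"
    then have "inverse w \<in> V" "w \<noteq> 0" using place_valuation[OF place, of w] zero_mem by auto
    then have "w\<^sup>2 * inverse w \<in> V" by (intro mult_mem w2V)
    moreover have "w\<^sup>2 * inverse w = w" using \<open>w \<noteq> 0\<close> by (simp add: power2_eq_square)
    ultimately show False using nw by simp
  qed
  have wN: "w\<^sup>2 * ?N = const_rf (d\<^sup>2)" using w N0 by simp
  have "(residue V w)\<^sup>2 * residue V ?N = d\<^sup>2"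
    using arg_cong[OF wN, of "residue V"] by (simp add: hom_mult hom_power w2V N wV)
  then have "(residue V w)\<^sup>2 = \<omega>\<^sup>2" using rN rN0 by (metis mult_right_cancel)
  then have "residue V w = \<omega> \<or> residue V (- w) = \<omega>"
    using hom_uminus[OF wV] by (auto simp: power2_eq_iff)
  then obtain w' where w': "w' \<in> V" "w'\<^sup>2 = w\<^sup>2" "residue V w' = \<omega>"
    using wV uminus_mem[OF wV] by (metis power2_minus)
  show ?thesis
  proof (rule that[of w'])
    show "w'\<^sup>2 * ?N = const_rf (d\<^sup>2)" using wN w'(2) by simp
    show "defined_at V (rf_offset f R w')" using so(1)[OF w'(1)] by (simp add: defined_at_def)
    show "value_at V (rf_offset f R w') = P + \<omega> *s grad2 f P"
      unfolding vec_eq_iff value_at_def using so(2)[OF w'(1)] w'(3) by simp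
  qed
qed

text \<open>
  A point of the locus of \<open>Q\<close> that lifts to \<open>R\<close> and \<open>w\<close> is an offset point, and almost all points lift.
\<close>
lemma finite_specializations_outside_offset_points:
  fixes R :: "('a::{alg_closed_field, field_char_0} ratfun_closure) ^ 2"
  assumes R: "rf_eval2 f (R $ 1) (R $ 2) = 0" and w: "w\<^sup>2 * rf_grad_sq f R = const_rf (d\<^sup>2)"
    and nonconst: "\<not> (\<forall>i. rf_offset f R w $ i \<in> range const_rf)"
  shows "finite (specializations_of (rf_offset f R w) - offset_points f d)"
proof -
  let ?Q = "rf_offset f R w" and ?zs = "{R $ 1, R $ 2, w}"
  let ?U = "{(a, b). specializes_over {} (?Q $ 1) (?Q $ 2) a b \<and>
    \<not> specializes_over ?zs (?Q $ 1) (?Q $ 2) a b}"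
  have "finite ?U"
    by (rule finite_nonlifting) (use nonconst in \<open>auto simp: forall_2\<close>)
  moreover have "specializations_of ?Q - offset_points f d \<subseteq> (\<lambda>(a, b). vector [a, b]) ` ?U"
  proof
    fix u assume u: "u \<in> specializations_of ?Q - offset_points f d"
    have "specializes_over {} (?Q $ 1) (?Q $ 2) (u $ 1) (u $ 2)"
      using u specializations_of_imp_specializes by blast
    moreover have "\<not> specializes_over ?zs (?Q $ 1) (?Q $ 2) (u $ 1) (u $ 2)"
    proof
      assume "specializes_over ?zs (?Q $ 1) (?Q $ 2) (u $ 1) (u $ 2)"
      then obtain A \<phi> where A: "specialization A \<phi>" "R $ 1 \<in> A" "R $ 2 \<in> A" "w \<in> A"
        and \<phi>: "\<phi> (?Q $ 1) = u $ 1" "\<phi> (?Q $ 2) = u $ 2"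
        unfolding specializes_over_def by blast
      have "\<forall>i. u $ i = \<phi> (?Q $ i)" unfolding forall_2 using \<phi> by simp
      then have "u \<in> offset_points f d"
        by (intro specialize_in_offset_points[OF A R w]) blast
      with u show False by blast
    qed
    moreover have "u = vector [u $ 1, u $ 2]" by (simp add: vec_eq_iff forall_2)
    ultimately show "u \<in> (\<lambda>(a, b). vector [a, b]) ` ?U"
      by (intro image_eqI[of _ _ "(u $ 1, u $ 2)"]) simp_all
  qed
  ultimately show ?thesis by (rule finite_surj)
qed

section \<open>Offsets of curves parametrizable by radicals\<close>

theorem proposition2p10:
  fixes f :: "'a::{alg_closed_field, field_char_0} poly poly"
    and C :: "('a ^ 2) set"
    and d :: 'a
    and pl :: "'a \<Rightarrow> 'a ratfun_closure set"
  assumes places: "\<And>t0. place_at t0 (pl t0)"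
    and irred: "Factorial_Ring.irreducible f"
    and curve: "C = plane_curve f"
    and param: "parametrizable_by_radicals pl C"
    and d: "d \<noteq> 0"
  shows "parametrizable_by_radicals pl (offset f d)"
proof -
  obtain Ps where Ps: "finite Ps" "\<And>R. R \<in> Ps \<Longrightarrow> square_parametrization R"
    and on_C: "\<And>R t0. R \<in> Ps \<Longrightarrow> defined_at (pl t0) R \<Longrightarrow> value_at (pl t0) R \<in> C"
    and cover: "finite {P \<in> C. \<not> (\<exists>t0. \<exists>R\<in>Ps. defined_at (pl t0) R \<and> P = value_at (pl t0) R)}"
      (is "finite ?U")
    using param unfolding parametrizable_by_radicals_def by blast
  have off: "offset f d = zariski_closure (offset_points f d)"
    by (rule offset_conv_offset_points[OF d])
  have generic: "rf_eval2 f (R $ 1) (R $ 2) = 0" if "R \<in> Ps" for R :: "('a ratfun_closure) ^ 2"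
  proof (rule generic_point_on_zero_set[of pl, OF places])
    have none: "{t0. defined_at (pl t0) R \<and> eval2 f (value_at (pl t0) R) \<noteq> 0} = {}"
      using on_C[OF that] unfolding curve plane_curve_def by blast
    show "finite {t0. defined_at (pl t0) R \<and> eval2 f (value_at (pl t0) R) \<noteq> 0}"
      unfolding none by simp
  qed
  define W where "W = (SIGMA R:Ps. {w. w\<^sup>2 * rf_grad_sq f R = const_rf (d\<^sup>2)})"
  have "finite {w. w\<^sup>2 * rf_grad_sq f R = const_rf (d\<^sup>2)}" for R
    by (rule finite_square_roots) (use d in simp)
  then have W: "finite W" unfolding W_def using Ps(1) by blast
  define is_const where "is_const Q \<longleftrightarrow> (\<forall>i. Q $ i \<in> range const_rf)"
    for Q :: "('a ratfun_closure) ^ 2"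
  define Q where "Q = (\<lambda>(R, w). rf_offset f R w)"
  define N where "N = {p \<in> W. \<not> is_const (Q p)}"
  have N: "finite N" using W by (simp add: N_def)
  have Nrel: "rf_eval2 f (R $ 1) (R $ 2) = 0" "w\<^sup>2 * rf_grad_sq f R = const_rf (d\<^sup>2)"
    "R \<in> Ps" "\<not> (\<forall>i. rf_offset f R w $ i \<in> range const_rf)" if "(R, w) \<in> N"
    for R :: "('a ratfun_closure) ^ 2" and w
    using that generic by (auto simp: N_def W_def Q_def is_const_def)
  define covered where "covered u \<longleftrightarrow> (\<exists>t0. \<exists>S\<in>Q ` N. defined_at (pl t0) S \<and> u = value_at (pl t0) S)" for u
  \<comment> \<open>the offset points over the uncovered points of the curve, and the values of the constant pairs\<close>
  define D where "D = (\<Union>P\<in>?U. (\<lambda>w. P + w *s grad2 f P) `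
      {w. w\<^sup>2 * ((grad2 f P $ 1)\<^sup>2 + (grad2 f P $ 2)\<^sup>2) = d\<^sup>2}) \<union>
    (\<lambda>p. \<chi> i. inv_into UNIV const_rf (Q p $ i)) ` W"
  have "finite {w. w\<^sup>2 * ((grad2 f P $ 1)\<^sup>2 + (grad2 f P $ 2)\<^sup>2) = d\<^sup>2}" for P
    by (rule finite_square_roots) (use d in simp)
  then have D: "finite D" unfolding D_def using cover W by blast
  have dichotomy: "u \<in> D \<or> covered u" if "u \<in> offset_points f d" for u
  proof -
    obtain P \<omega> where P: "eval2 f P = 0" "u = P + \<omega> *s grad2 f P"
      and \<omega>: "\<omega>\<^sup>2 * ((grad2 f P $ 1)\<^sup>2 + (grad2 f P $ 2)\<^sup>2) = d\<^sup>2"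
      using \<open>u \<in> offset_points f d\<close> unfolding offset_points_def by blast
    show ?thesis
    proof (cases "P \<in> ?U")
      case True
      then have "u \<in> D" unfolding D_def P(2) using \<omega> by blast
      then show ?thesis ..
    next
      case False
      moreover have "P \<in> C" using P(1) by (simp add: curve plane_curve_def)
      ultimately obtain t0 R where R: "R \<in> Ps" "defined_at (pl t0) R" "P = value_at (pl t0) R"
        by blast
      obtain w where w: "w\<^sup>2 * rf_grad_sq f R = const_rf (d\<^sup>2)"
        "defined_at (pl t0) (rf_offset f R w)" "value_at (pl t0) (rf_offset f R w) = u"
        using offset_points_over_value[OF places R(2,3) d \<omega>] P(2) by metis
      have p: "(R, w) \<in> W" using R(1) w(1) by (simp add: W_def)
      show ?thesis
      proof (cases "is_const (Q (R, w))")
        case True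
        interpret specialization "pl t0" "residue (pl t0)"
          by (rule place_specialization[OF places])
        have "inv_into UNIV const_rf (Q (R, w) $ i) = u $ i" for i
        proof -
          obtain c where c: "Q (R, w) $ i = const_rf c" using True by (auto simp: is_const_def)
          then have "u $ i = c" unfolding w(3)[symmetric] by (simp add: value_at_def Q_def)
          moreover have "inv_into UNIV const_rf (const_rf c) = c" by (rule inv_f_f) (simp add: inj_def)
          ultimately show ?thesis using c by simp
        qed
        then have "u = (\<chi> i. inv_into UNIV const_rf (Q (R, w) $ i))" by (simp add: vec_eq_iff)
        with p have "u \<in> D" unfolding D_def by blast
        then show ?thesis ..
      next
        case False
        with p have "(R, w) \<in> N" by (simp add: N_def)
        moreover have "Q (R, w) = rf_offset f R w" by (simp add: Q_def)
        ultimately have "covered u" unfolding covered_def using w(2,3) by (metis image_eqI)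
        then show ?thesis ..
      qed
    qed
  qed
  have "covered u \<Longrightarrow> u \<in> (\<Union>p\<in>N. specializations_of (Q p))" for u
    unfolding covered_def using value_in_specializations[OF places] by blast
  with dichotomy have "offset_points f d \<subseteq> D \<union> (\<Union>p\<in>N. specializations_of (Q p))" by blast
  then have closure: "offset f d \<subseteq> D \<union> (\<Union>p\<in>N. specializations_of (Q p))"
    unfolding off
    by (rule zariski_closure_subset)
      (intro zariski_closed_Un zariski_closed_finite[OF D] zariski_closed_UN[OF N]
        zariski_closed_specializations)
  have "{u \<in> offset f d. \<not> covered u} \<subseteq>
      D \<union> (\<Union>p\<in>N. specializations_of (Q p) - offset_points f d)"
    using closure dichotomy by blast
  moreover have "finite (specializations_of (Q p) - offset_points f d)" if "p \<in> N" for p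
  proof -
    obtain R w where p: "p = (R, w)" by (cases p)
    show ?thesis
      using finite_specializations_outside_offset_points[OF Nrel(1,2,4)] that
      unfolding p Q_def by simp
  qed
  ultimately have fin: "finite {u \<in> offset f d. \<not> covered u}"
    using D N by (meson finite_UN_I finite_Un finite_subset)
  have sq: "square_parametrization S" if "S \<in> Q ` N" for S
  proof -
    obtain R w where S: "(R, w) \<in> N" "S = rf_offset f R w"
      using \<open>S \<in> Q ` N\<close> by (auto simp: Q_def)
    show ?thesis
      unfolding S(2)
      by (rule square_parametrization_rf_offset[OF Ps(2)[OF Nrel(3)[OF S(1)]] d Nrel(2)[OF S(1)] Nrel(4)[OF S(1)]])
  qed
  have val: "value_at (pl t0) S \<in> offset f d" if S: "S \<in> Q ` N" and def: "defined_at (pl t0) S" for S t0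
  proof -
    obtain R w where Rw: "(R, w) \<in> N" "S = rf_offset f R w"
      using S by (auto simp: Q_def)
    show ?thesis
      unfolding off Rw(2)
      by (rule value_rf_offset_in_closure[of pl, OF places Nrel(1,2)[OF Rw(1)]])
        (use def Rw(2) in simp)
  qed
  show ?thesis
    unfolding parametrizable_by_radicals_def
    using N sq val fin unfolding covered_def
    by (intro exI[of _ "Q ` N"]) blast
qed

end
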